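(* Let $G=\mathrm{SL}(n,\mathbb{C})$ with $n\ge 2$, let $\lambda$ be a dominant weight, let $F=G/P_\lambda$ with its very ample line bundle $L_\lambda$, and let $\mu$ be any weight such that $\lambda-\mu$ lies in the root lattice of $\mathrm{SL}(n,\mathbb{C})$. Equip $L_\lambda$ with the $\mu$-linearization. If $p\in F$ is $\mu$-semistable, then there is a $T$-invariant global section $s$ of $L_\lambda$ (invariant with respect to the $\mu$-linearization) such that $s(p)\neq 0$.
   Context: $T\subset G=\mathrm{SL}(n,\mathbb{C})$ is the subgroup of diagonal matrices, $B\subset G$ the subgroup of upper triangular matrices. Characters of $T$ (equivalently weights) are identified with elements of $\mathbb{Z}^n/\Delta$, where $\Delta=\mathbb{Z}(1,\dots,1)$: the weight $\mu=(a_1,\dots,a_n)$ corresponds to the character $e^\mu(\mathrm{diag}(t_1,\dots,t_n))=\prod_i t_i^{a_i}$. The roots are the classes of $e_i-e_j$, $i\ne j$ (with $e_i$ the standard basis vectors), and the root lattice is the subgroup of $\mathbb{Z}^n/\Delta$ they generate. A weight $\lambda=(a_1,\dots,a_n)$ is dominant if $a_1\ge a_2\ge\cdots\ge a_n$. For $\lambda$ dominant, $P_\lambda\supseteq B$ is the largest parabolic subgroup of $G$ (possibly $G$ itself) to which $e^\lambda$ extends as a character, this extension (which is unique) again being denoted $e^\lambda$. The line bundle $L_\lambda$ on $G/P_\lambda$ has total space the set of pairs $(g,z)\in G\times\mathbb{C}$ modulo $(g,z)\sim(gp,e^\lambda(p)z)$, $p\in P_\lambda$. Its global sections are $s_f(gP_\lambda)=[(g,f(g))]$,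 where $f:G\to\mathbb{C}$ is holomorphic and $f(gp)=e^\lambda(p)f(g)$ for all $g\in G,\ p\in P_\lambda$; thus $s_f(gP_\lambda)\ne0$ iff $f(g)\neq 0$. For $N\geq 1$, $L_\lambda^{\otimes N}\cong L_{N\lambda}$, so sections of $L_\lambda^{\otimes N}$ are given by holomorphic $f$ with $f(gp)=e^{N\lambda}(p)f(g)$. The $\mu$-linearization of $L_\lambda$ is the $T$-action $t\cdot(g,z)=(tg,e^\mu(t)z)$. With respect to it, a section $s_f$ of $L_\lambda^{\otimes N}$ is $T$-invariant iff $f(tg)=e^{N\mu}(t)f(g)$ for all $t\in T$, $g\in G$. A point $p\in F$ is $\mu$-semistable if there exist a positive integer $N$ and a global section $s$ of $L_\lambda^{\otimes N}$, $T$-invariant for the $\mu$-linearization, such that $s(p)\neq0$. *)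

theory Defs
  imports "HOL-Analysis.Analysis" "HOL-Algebra.Algebra"
begin

text \<open>
  Here n is \<open>CARD('n)\<close>; the linear order on the finite index type \<open>'n\<close> plays the role of
  \<open>1 < \<dots> < n\<close>.
\<close>

section \<open>The group SL(n,C), its torus and its upper triangular subgroup\<close>

definition SL :: "(complex^'n::finite^'n) monoid" where
  "SL = \<lparr>carrier = {A. det A = 1}, mult = (**), one = mat 1\<rparr>"

definition torus_T :: "(complex^'n::finite^'n) set" where
  "torus_T = {t \<in> carrier SL. \<forall>i j. i \<noteq> j \<longrightarrow> t$i$j = 0}"

definition borel_B :: "(complex^'n::{finite,linorder}^'n::{finite,linorder}) set" where
  "borel_B = {b \<in> carrier SL. \<forall>i j. j < i \<longrightarrow> b$i$j = 0}"

definition Cstar :: "complex monoid" where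
  "Cstar = \<lparr>carrier = UNIV - {0}, mult = (*), one = 1\<rparr>"

section \<open>Weights\<close>

text \<open>The quotient of \<open>\<int>\<^sup>n\<close> by \<open>\<Delta> = \<int>(1,\<dots>,1)\<close>; note \<open>range vec = \<Delta>\<close>.\<close>

quotient_type (overloaded) 'n weight = "int^'n::finite" / "\<lambda>a b. a - b \<in> range vec"
  morphisms rep_weight weight_of
proof (rule equivpI)
  show "reflp (\<lambda>a b::int^'n. a - b \<in> range vec)"
    by (auto simp: reflp_def intro!: image_eqI[of _ _ 0])
  show "symp (\<lambda>a b::int^'n. a - b \<in> range vec)"
  proof (rule sympI)
    fix a b :: "int^'n" assume "a - b \<in> range vec"
    then obtain k where "a - b = vec k" by auto
    then have "b - a = vec (- k)" by (auto simp: vec_eq_iff algebra_simps)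
    then show "b - a \<in> range vec" by simp
  qed
  show "transp (\<lambda>a b::int^'n. a - b \<in> range vec)"
  proof (rule transpI)
    fix a b c :: "int^'n" assume "a - b \<in> range vec" "b - c \<in> range vec"
    then obtain k l where "a - b = vec k" "b - c = vec l" by auto
    then have "a - c = vec (k + l)" by (auto simp: vec_eq_iff algebra_simps)
    then show "a - c \<in> range vec" by simp
  qed
qed

lemma weight_rel_iff:
  fixes a b :: "int^'n::finite"
  shows "a - b \<in> range vec \<longleftrightarrow> (\<exists>k. \<forall>i. a$i = b$i + k)"
proof -
  have "a - b \<in> range vec \<longleftrightarrow> (\<exists>k. a - b = vec k)" by auto
  also have "\<dots> \<longleftrightarrow> (\<exists>k. \<forall>i. a$i = b$i + k)"
    by (auto simp: vec_eq_iff algebra_simps)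
  finally show ?thesis .
qed

instantiation weight :: (finite) ab_group_add
begin

lift_definition zero_weight :: "'a weight" is 0 .

lift_definition plus_weight :: "'a weight \<Rightarrow> 'a weight \<Rightarrow> 'a weight" is "(+)"
  unfolding weight_rel_iff
proof (elim exE)
  fix a b c d :: "int^'a" and k l
  assume "\<forall>i. a$i = b$i + k" "\<forall>i. c$i = d$i + l"
  then show "\<exists>m. \<forall>i. (a + c)$i = (b + d)$i + m" by (intro exI[of _ "k + l"]) simp
qed

lift_definition uminus_weight :: "'a weight \<Rightarrow> 'a weight" is uminus
  unfolding weight_rel_iff
proof (elim exE)
  fix a b :: "int^'a" and k
  assume "\<forall>i. a$i = b$i + k"
  then show "\<exists>m. \<forall>i. (- a)$i = (- b)$i + m" by (intro exI[of _ "- k"]) simp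
qed

definition minus_weight :: "'a weight \<Rightarrow> 'a weight \<Rightarrow> 'a weight" where
  "minus_weight v w = v + - w"

instance
proof
  have z: "(0::int^'a) \<in> range vec"
    by (rule image_eqI[of _ _ 0]) (auto simp: vec_eq_iff)
  fix u v w :: "'a weight"
  show "u + v + w = u + (v + w)" by transfer (simp add: z)
  show "u + v = v + u" by transfer (simp add: z)
  show "0 + u = u" by transfer (simp add: z)
  show "- u + u = 0" by transfer (simp add: z)
  show "u - v = u + - v" by (simp add: minus_weight_def)
qed

end

lift_definition nmult :: "nat \<Rightarrow> 'n::finite weight \<Rightarrow> 'n weight" is
  "\<lambda>N a. \<chi> i. int N * a$i"
  unfolding weight_rel_iff
proof (elim exE)
  fix N and a b :: "int^'n" and k
  assume "\<forall>i. a$i = b$i + k"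
  then show "\<exists>m. \<forall>i. (\<chi> i. int N * a$i)$i = (\<chi> i. int N * b$i)$i + m"
    by (intro exI[of _ "int N * k"]) (simp add: algebra_simps)
qed

lift_definition dominant :: "'n::{finite,linorder} weight \<Rightarrow> bool" is
  "\<lambda>a. \<forall>i j. i \<le> j \<longrightarrow> a$j \<le> a$i"
  unfolding weight_rel_iff by auto

definition root_set :: "'n::finite weight set" where
  "root_set = {weight_of (axis i 1 - axis j 1) | i j. i \<noteq> j}"

definition root_lattice :: "'n::finite weight set" where
  "root_lattice = generate \<lparr>carrier = UNIV, mult = (+), one = 0\<rparr> root_set"

text \<open>
  The character of the torus attached to a weight. It depends only on the class of the exponent
  vector because the diagonal entries have product 1, which is why it is restricted to the torus.
\<close>

lemma prod_diagonal_torus: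
  assumes "t \<in> torus_T" shows "(\<Prod>i\<in>UNIV. t$i$i) = 1"
  using assms det_diagonal[of t] by (simp add: torus_T_def SL_def)

lift_definition torus_char :: "'n::finite weight \<Rightarrow> complex^'n^'n \<Rightarrow> complex" is
  "\<lambda>a. restrict (\<lambda>t. \<Prod>i\<in>UNIV. (t$i$i) powi (a$i)) torus_T"
  unfolding weight_rel_iff
proof (elim exE, rule restrict_ext)
  fix a b :: "int^'n" and k and t :: "complex^'n^'n"
  assume ab: "\<forall>i. a$i = b$i + k" and t: "t \<in> torus_T"
  have p1: "(\<Prod>i\<in>UNIV. t$i$i) = 1" by (rule prod_diagonal_torus[OF t])
  then have nz: "t$i$i \<noteq> 0" for i
    by (metis UNIV_I finite prod_zero_iff zero_neq_one)
  have "(\<Prod>i\<in>UNIV. (t$i$i) powi (a$i)) = (\<Prod>i\<in>UNIV. (t$i$i) powi (b$i) * (t$i$i) powi k)"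
    using ab nz by (simp add: power_int_add)
  also have "\<dots> = (\<Prod>i\<in>UNIV. (t$i$i) powi (b$i)) * (\<Prod>i\<in>UNIV. t$i$i) powi k"
    by (simp add: prod.distrib power_int_def prod_power_distrib[symmetric]
        prod_inversef[unfolded o_def, symmetric])
  finally show "(\<Prod>i\<in>UNIV. (t$i$i) powi (a$i)) = (\<Prod>i\<in>UNIV. (t$i$i) powi (b$i))"
    using p1 by simp
qed

section \<open>Holomorphic functions\<close>

definition holomorphic_at_matrix ::
    "(complex^'n::finite^'n \<Rightarrow> complex) \<Rightarrow> complex^'n^'n \<Rightarrow> bool" where
  "holomorphic_at_matrix h x \<longleftrightarrow>
     (\<exists>D. (h has_derivative D) (at x) \<and> (\<forall>c A. D (\<chi> i. c *s A$i) = c * D A))"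

text \<open>
  For a complex submanifold of the space of matrices (such as SL(n,C) and its closed complex
  subgroups), a function is holomorphic iff it is locally the restriction of a holomorphic
  function on an open set of matrices.
\<close>

definition holomorphic_on_submfd ::
    "(complex^'n::finite^'n) set \<Rightarrow> (complex^'n^'n \<Rightarrow> complex) \<Rightarrow> bool" where
  "holomorphic_on_submfd M f \<longleftrightarrow>
     (\<forall>x\<in>M. \<exists>U h. open U \<and> x \<in> U \<and> (\<forall>y\<in>U. holomorphic_at_matrix h y) \<and>
        (\<forall>y\<in>U \<inter> M. h y = f y))"

section \<open>Parabolic subgroups and extension of characters\<close>

text \<open>The Borel subgroups of SL(n,C) are the conjugates of \<open>borel_B\<close>.\<close>

definition parabolic :: "(complex^'n::{finite,linorder}^'n::{finite,linorder}) set \<Rightarrow> bool" where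
  "parabolic P \<longleftrightarrow> subgroup P SL \<and> closed P \<and>
     (\<exists>g\<in>carrier SL. (g <#\<^bsub>SL\<^esub> borel_B) #>\<^bsub>SL\<^esub> (inv\<^bsub>SL\<^esub> g) \<subseteq> P)"

definition extends_to ::
    "'n::finite weight \<Rightarrow> (complex^'n^'n) set \<Rightarrow> (complex^'n^'n \<Rightarrow> complex) \<Rightarrow> bool" where
  "extends_to \<nu> P \<psi> \<longleftrightarrow> \<psi> \<in> hom (SL\<lparr>carrier := P\<rparr>) Cstar \<and> holomorphic_on_submfd P \<psi> \<and>
     (\<forall>t\<in>torus_T. \<psi> t = torus_char \<nu> t)"

text \<open>\<open>GREATEST\<close> is with respect to inclusion.\<close>

definition P_of :: "'n::{finite,linorder} weight \<Rightarrow> (complex^'n::{finite,linorder}^'n::{finite,linorder}) set" where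
  "P_of lam = (GREATEST P. parabolic P \<and> borel_B \<subseteq> P \<and> (\<exists>\<psi>. extends_to lam P \<psi>))"

text \<open>The unique extension to \<open>P\<close>, taking a dummy value outside \<open>P\<close>.\<close>

definition ext_char ::
    "(complex^'n::finite^'n) set \<Rightarrow> 'n weight \<Rightarrow> complex^'n^'n \<Rightarrow> complex" where
  "ext_char P \<nu> = (THE \<psi>. \<psi> \<in> extensional P \<and> extends_to \<nu> P \<psi>)"

section \<open>Flag varieties, line bundles and their sections\<close>

text \<open>
  The bundle on \<open>G/P\<close> attached to the character of \<open>P\<close> given by \<open>\<nu>\<close>. For \<open>P = P_of lam\<close>, the case
  \<open>\<nu> = lam\<close> is the line bundle of the dominant weight \<open>lam\<close> and \<open>\<nu> = nmult N lam\<close> its N-th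
  tensor power.
\<close>

definition bundle_rel ::
    "(complex^'n::finite^'n) set \<Rightarrow> 'n weight \<Rightarrow>
     (((complex^'n^'n) \<times> complex) \<times> ((complex^'n^'n) \<times> complex)) set" where
  "bundle_rel P \<nu> = {((g, z), (g ** p, ext_char P \<nu> p * z)) | g z p. g \<in> carrier SL \<and> p \<in> P}"

definition line_bundle ::
    "(complex^'n::finite^'n) set \<Rightarrow> 'n weight \<Rightarrow> ((complex^'n^'n) \<times> complex) set set" where
  "line_bundle P \<nu> = (carrier SL \<times> UNIV) // bundle_rel P \<nu>"

definition global_sections ::
    "(complex^'n::finite^'n) set \<Rightarrow> 'n weight \<Rightarrow>
     ((complex^'n^'n) set \<Rightarrow> ((complex^'n^'n) \<times> complex) set) set" where
  "global_sections P \<nu> = {s \<in> (lcosets\<^bsub>SL\<^esub> P) \<rightarrow>\<^sub>E line_bundle P \<nu>.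
     \<exists>f. holomorphic_on_submfd (carrier SL) f \<and>
         (\<forall>g\<in>carrier SL. \<forall>p\<in>P. f (g ** p) = ext_char P \<nu> p * f g) \<and>
         (\<forall>g\<in>carrier SL. s (g <#\<^bsub>SL\<^esub> P) = bundle_rel P \<nu> `` {(g, f g)})}"

text \<open>The zero of the fibre over \<open>x = gP\<close>: the class of \<open>(g, 0)\<close> is \<open>gP \<times> {0}\<close>.\<close>

definition zero_over :: "(complex^'n::finite^'n) set \<Rightarrow> ((complex^'n^'n) \<times> complex) set" where
  "zero_over x = x \<times> {0}"

text \<open>
  The \<open>\<mu>\<close>-linearization; the image of the class of \<open>(g, z)\<close> is the class of \<open>(tg, e\<^sup>\<mu>(t)z)\<close>.
  The torus acts on cosets by \<open>x \<mapsto> tx\<close>, and a section is invariant iff it is equivariant for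
  these two actions.
\<close>

definition linearization ::
    "'n::finite weight \<Rightarrow> complex^'n^'n \<Rightarrow> ((complex^'n^'n) \<times> complex) set \<Rightarrow>
     ((complex^'n^'n) \<times> complex) set" where
  "linearization \<mu> t E = (\<lambda>(g, z). (t ** g, torus_char \<mu> t * z)) ` E"

definition T_invariant ::
    "(complex^'n::finite^'n) set \<Rightarrow> 'n weight \<Rightarrow>
     ((complex^'n^'n) set \<Rightarrow> ((complex^'n^'n) \<times> complex) set) \<Rightarrow> bool" where
  "T_invariant P \<mu> s \<longleftrightarrow>
     (\<forall>t\<in>torus_T. \<forall>x\<in>lcosets\<^bsub>SL\<^esub> P. s (t <#\<^bsub>SL\<^esub> x) = linearization \<mu> t (s x))"

text \<open>The \<open>\<mu>\<close>-linearization of a line bundle induces the \<open>N\<mu>\<close>-linearization of its N-th tensor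
  power.\<close>

definition semistable ::
    "'n::{finite,linorder} weight \<Rightarrow> 'n weight \<Rightarrow> (complex^'n::{finite,linorder}^'n::{finite,linorder}) set \<Rightarrow> bool" where
  "semistable lam \<mu> x \<longleftrightarrow>
     (\<exists>N>0. \<exists>s\<in>global_sections (P_of lam) (nmult N lam).
        T_invariant (P_of lam) (nmult N \<mu>) s \<and> s x \<noteq> zero_over x)"

end

theory Submission
  imports Defs
begin

text \<open>
  Let \<open>a\<close>, \<open>m\<close> be lifts of \<open>lam\<close>, \<open>\<mu>\<close> to \<open>\<int>\<^sup>n\<close> with equal coordinate sums and \<open>a \<ge> 0\<close>, and let \<open>f\<close> be a
  semi-invariant function of weight \<open>(N lam, N \<mu>)\<close> with \<open>f g \<noteq> 0\<close>. For a set \<open>S\<close> of rows let \<open>J\<close>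
  be the set of pivot columns of the rows \<open>S\<close> of \<open>g\<close>. Suitable one-parameter subgroups \<open>t\<close>, \<open>d\<close> of \<open>T\<close>
  and some \<open>u \<in> B\<close> make \<open>t(1/z) g u d(z)\<close> converge in SL(n,C) as \<open>z \<rightarrow> 0\<close>, while \<open>f\<close> scales
  by \<open>z\<close> to the power \<open>n N (a(J) - m(S))\<close>; by continuity \<open>m(S) \<le> a(J)\<close>. Summing by parts over the levels
  \<open>D\<^sub>c = {j. a\<^sub>j \<ge> c}\<close>, \<open>a(J)\<close> is at most the sum of the ranks of the submatrices of \<open>g\<close> with rows \<open>S\<close> and
  columns \<open>D\<^sub>c\<close>. Rado's theorem for this submodular function yields sets of rows \<open>I\<^sub>c\<close> such that
  the minors of \<open>g\<close> with rows \<open>I\<^sub>c\<close> and columns \<open>D\<^sub>c\<close> do not vanish and each \<open>i\<close> lies in \<open>m\<^sub>i\<close> of the \<open>I\<^sub>c\<close>.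
  The product of these minors is the required section.

  The same degeneration, applied to a character of a closed subgroup containing \<open>B\<close>, has exponent zero and
  identifies \<open>P_of lam\<close> with the group of block triangular matrices.
\<close>

section \<open>Rado's theorem for submodular functions\<close>

text \<open>As long as some \<open>A i\<close> has two elements, submodularity allows one of them to be discarded.\<close>

lemma rado_submodular:
  fixes \<rho> :: "'e set \<Rightarrow> nat" and A :: "'i \<Rightarrow> 'e set"
  assumes "finite I" and "\<And>i. i \<in> I \<Longrightarrow> finite (A i)"
    and mono: "\<And>U V. U \<subseteq> V \<Longrightarrow> \<rho> U \<le> \<rho> V"
    and submod: "\<And>U V. \<rho> (U \<union> V) + \<rho> (U \<inter> V) \<le> \<rho> U + \<rho> V"
    and empty: "\<rho> {} = 0"
    and "\<And>K. K \<subseteq> I \<Longrightarrow> card K \<le> \<rho> (\<Union>i\<in>K. A i)"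
  shows "\<exists>x. (\<forall>i\<in>I. x i \<in> A i) \<and> card I \<le> \<rho> (x ` I)"
  using assms(2,6)
proof (induction "\<Sum>i\<in>I. card (A i)" arbitrary: A rule: less_induct)
  case less
  note fin = less.prems(1) and cond = less.prems(2)
  have ne: "A i \<noteq> {}" if "i \<in> I" for i
    using cond[of "{i}"] that empty by auto
  show ?case
  proof (cases "\<exists>k\<in>I. \<exists>x\<in>A k. \<exists>y\<in>A k. x \<noteq> y")
    \<comment> \<open>Every \<open>A i\<close> is now a singleton, so the union of the
      \<open>A i\<close> is the image of the choice function.\<close>
    case False
    define x where "x i = (SOME z. z \<in> A i)" for i
    have x: "x i \<in> A i" if "i \<in> I" for i
      using ne[OF that] some_in_eq unfolding x_def by blast
    have "(\<Union>i\<in>I. A i) \<subseteq> x ` I" using False x by blast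
    then have "card I \<le> \<rho> (x ` I)"
      using cond[of I] mono order_trans by blast
    then show ?thesis using x by blast
  next
    case True
    then obtain k x y where k: "k \<in> I" and xy: "x \<in> A k" "y \<in> A k" "x \<noteq> y" by blast
    \<comment> \<open>Deleting \<open>z\<close> from \<open>A k\<close> affects the hypothesis only
      for index sets containing \<open>k\<close>; \<open>c\<close> is the hypothesis for these, with
      \<open>k\<close> split off.\<close>
    have red: ?thesis if z: "z \<in> A k"
      and c: "\<And>K. K \<subseteq> I - {k} \<Longrightarrow> Suc (card K) \<le> \<rho> ((\<Union>i\<in>K. A i) \<union> (A k - {z}))" for z
    proof -
      let ?A = "A(k := A k - {z})"
      have lt: "(\<Sum>i\<in>I. card (?A i)) < (\<Sum>i\<in>I. card (A i))"
        using fin k z assms(1)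
        by (intro sum_strict_mono_ex1) (auto intro!: card_Diff1_less card_mono simp del: card_Diff_insert)
      have cK: "card K \<le> \<rho> (\<Union>i\<in>K. ?A i)" if "K \<subseteq> I" for K
      proof (cases "k \<in> K")
        case True
        have "(\<Union>i\<in>K. ?A i) = (\<Union>i\<in>K - {k}. A i) \<union> (A k - {z})"
          using True by (auto split: if_splits)
        moreover have "Suc (card (K - {k})) = card K"
          using True that assms(1) by (meson card_Suc_Diff1 finite_subset)
        ultimately show ?thesis using c[of "K - {k}"] that by (metis Diff_mono subset_refl)
      next
        case False
        then have "(\<Union>i\<in>K. ?A i) = (\<Union>i\<in>K. A i)" by auto
        then show ?thesis using cond[OF that] by simp
      qed
      have "\<exists>x. (\<forall>i\<in>I. x i \<in> ?A i) \<and> card I \<le> \<rho> (x ` I)"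
        by (rule less.hyps[OF lt]) (use fin cK in auto)
      then obtain w where w: "\<forall>i\<in>I. w i \<in> ?A i" "card I \<le> \<rho> (w ` I)" by blast
      have "w i \<in> A i" if "i \<in> I" for i
        using w(1) that by (cases "i = k") force+
      then show ?thesis using w(2) by blast
    qed
    show ?thesis
    proof (rule ccontr)
      assume "\<not> ?thesis"
      then obtain K L where K: "K \<subseteq> I - {k}" "\<rho> ((\<Union>i\<in>K. A i) \<union> (A k - {x})) \<le> card K"
        and L: "L \<subseteq> I - {k}" "\<rho> ((\<Union>i\<in>L. A i) \<union> (A k - {y})) \<le> card L"
        using red[OF xy(1)] red[OF xy(2)] by (metis not_less_eq_eq)
      \<comment> \<open>\<open>?U \<union> ?V\<close> contains all of \<open>A k\<close> because
        \<open>x\<close> and \<open>y\<close> differ, so the hypothesis applies to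
        \<open>insert k (K \<union> L)\<close>; \<open>?U \<inter> ?V\<close> contains the union
        over \<open>K \<inter> L\<close>. Submodularity is then violated by one, the contribution of
        \<open>k\<close>.\<close>
      let ?U = "(\<Union>i\<in>K. A i) \<union> (A k - {x})" and ?V = "(\<Union>i\<in>L. A i) \<union> (A k - {y})"
      have finKL: "finite K" "finite L" using K L assms(1) finite_subset by blast+
      have "insert k (K \<union> L) \<subseteq> I" using K L k by blast
      then have "card (insert k (K \<union> L)) \<le> \<rho> (\<Union>i\<in>insert k (K \<union> L). A i)" by (rule cond)
      moreover have "(\<Union>i\<in>insert k (K \<union> L). A i) = ?U \<union> ?V" using xy by auto
      then have "\<rho> (\<Union>i\<in>insert k (K \<union> L). A i) = \<rho> (?U \<union> ?V)" by (rule arg_cong)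
      moreover have "card (insert k (K \<union> L)) = Suc (card (K \<union> L))"
        using K L finKL by (subst card_insert_disjoint) auto
      moreover have "card (K \<inter> L) \<le> \<rho> (\<Union>i\<in>K \<inter> L. A i)" using K by (intro cond) auto
      moreover have "\<rho> (\<Union>i\<in>K \<inter> L. A i) \<le> \<rho> (?U \<inter> ?V)" by (rule mono) auto
      ultimately have "Suc (card (K \<union> L)) + card (K \<inter> L) \<le> card K + card L"
        using submod[of ?U ?V] K(2) L(2) by linarith
      then show False using card_Un_Int[OF finKL] by simp
    qed
  qed
qed

section \<open>Ranks of submatrices and pivots\<close>

text \<open>In the Leibniz expansion a permutation survives only if \<open>i \<le> p i\<close> for
  all \<open>i\<close>. The largest point moved by such a \<open>p\<close> would be sent to a fixed
  point, against injectivity, so \<open>p\<close> is the identity.\<close>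

lemma det_upper_triangular:
  fixes A :: "'a::comm_ring_1^'n::{finite,linorder}^'n::{finite,linorder}"
  assumes "\<And>i j. j < i \<Longrightarrow> A$i$j = 0"
  shows "det A = (\<Prod>i\<in>UNIV. A$i$i)"
proof -
  have id: "p = id" if p: "p permutes (UNIV::'n set)" and le: "\<And>i. i \<le> p i" for p
  proof (rule ccontr)
    assume "p \<noteq> id"
    then have ne: "{i. p i \<noteq> i} \<noteq> {}" by (auto simp: fun_eq_iff)
    define k where "k = Max {i. p i \<noteq> i}"
    have "p k \<noteq> k" using Max_in[OF _ ne] unfolding k_def by simp
    then have "k < p k" using le[of k] by simp
    then have "p (p k) = p k"
      using Max_ge[of "{i. p i \<noteq> i}" "p k"] unfolding k_def by fastforce
    then show False using \<open>p k \<noteq> k\<close> permutes_inj[OF p] by (auto dest: injD)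
  qed
  have zero: "of_int (sign p) * (\<Prod>i\<in>UNIV. A$i$p i) = 0"
    if "p \<in> {p. p permutes UNIV} - {id}" for p
  proof -
    have "p permutes UNIV" "p \<noteq> id" using that by auto
    then obtain i where "p i < i" using id[of p] by (meson not_le)
    then have "(\<Prod>i\<in>UNIV. A$i$p i) = 0" using assms by (intro prod_zero) auto
    then show ?thesis by simp
  qed
  have "det A = (\<Sum>p\<in>{id}. of_int (sign p) * (\<Prod>i\<in>UNIV. A$i$p i))"
    unfolding det_def using zero
    by (intro sum.mono_neutral_right) (auto simp: permutes_id finite_permutations)
  then show ?thesis by (simp add: sign_id)
qed

definition supported_on :: "'n set \<Rightarrow> (complex^'n::finite) set" where
  "supported_on D = {v. \<forall>j. j \<notin> D \<longrightarrow> v$j = 0}"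

definition row_kernel :: "complex^'n::finite^'n \<Rightarrow> 'n set \<Rightarrow> (complex^'n) set" where
  "row_kernel g S = {v. \<forall>i\<in>S. (g *v v)$i = 0}"

text \<open>By rank-nullity, the rank of the submatrix of \<open>g\<close> with rows \<open>S\<close> and columns \<open>D\<close>.\<close>

definition submatrix_rank :: "complex^'n::finite^'n \<Rightarrow> 'n set \<Rightarrow> 'n set \<Rightarrow> nat" where
  "submatrix_rank g D S = card D - vec.dim (supported_on D \<inter> row_kernel g S)"

lemma subspace_supported_on [simp]: "vec.subspace (supported_on D)"
  by (auto simp: vec.subspace_def supported_on_def)

lemma subspace_row_kernel [simp]: "vec.subspace (row_kernel g S)"
  by (auto simp: vec.subspace_def row_kernel_def matrix_vector_right_distrib vector_scalar_commute)

lemma dim_supported_on [simp]: "vec.dim (supported_on D) = card D"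
proof (rule vec.dim_unique)
  let ?B = "(\<lambda>j. axis j (1::complex)) ` D"
  show "?B \<subseteq> supported_on D" by (auto simp: supported_on_def axis_def)
  show "supported_on D \<subseteq> vec.span ?B"
  proof
    fix v :: "complex^'a" assume "v \<in> supported_on D"
    then have "v = (\<Sum>j\<in>UNIV. v$j *s axis j 1)" "\<And>j. j \<notin> D \<Longrightarrow> v$j = 0"
      by (auto simp: basis_expansion supported_on_def)
    then have "v = (\<Sum>j\<in>D. v$j *s axis j 1)"
      by (metis (no_types, lifting) DiffD2 finite subset_UNIV sum.mono_neutral_left vec.scale_eq_0_iff)
    moreover have "\<dots> \<in> vec.span ?B"
      by (intro vec.span_sum vec.span_scale vec.span_base) auto
    ultimately show "v \<in> vec.span ?B" by simp
  qed
  show "vec.independent ?B"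
    by (rule vec.independent_mono[OF independent_cart_basis]) (auto simp: cart_basis_def)
  show "card ?B = card D"
    by (rule card_image) (auto simp: inj_on_def axis_eq_axis)
qed

text \<open>The dimension formula for the sum of two subspaces, with the sum bounded by an ambient
  \<open>W\<close>. All rank inequalities below rest on it.\<close>

lemma dim_sum_le:
  fixes U V W :: "(complex^'n::finite) set"
  assumes "vec.subspace U" "vec.subspace V" "vec.subspace W" "U \<subseteq> W" "V \<subseteq> W"
  shows "vec.dim U + vec.dim V \<le> vec.dim W + vec.dim (U \<inter> V)"
proof -
  have "{x + y |x y. x \<in> U \<and> y \<in> V} \<subseteq> W"
    using assms by (auto intro: vec.subspace_add)
  then have "vec.dim {x + y |x y. x \<in> U \<and> y \<in> V} \<le> vec.dim W" by (rule vec.dim_subset)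
  then show ?thesis using vec.dim_sums_Int[OF assms(1,2)] by linarith
qed

lemma det_nonzero_inj:
  fixes g :: "complex^'n::finite^'n"
  assumes "det g \<noteq> 0" shows "inj ((*v) g)"
  using assms det_nz_iff_inj_gen[of "(*v) g"] by simp

text \<open>The condition defining \<open>row_kernel g S\<close> says that the image vector is
  supported off \<open>S\<close>, and \<open>g\<close> is surjective. This yields the dimension of
  the kernel.\<close>

lemma row_kernel_as_image:
  fixes g :: "complex^'n::finite^'n"
  assumes "det g \<noteq> 0"
  shows "(*v) g ` row_kernel g S = supported_on (- S)"
proof -
  have "surj ((*v) g)"
    using det_nonzero_inj[OF assms] by (metis matrix_vector_mul_linear_gen vec.linear_injective_imp_surjective)
  then show ?thesis unfolding row_kernel_def supported_on_def
    by (auto simp: image_iff) (metis surj_def)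
qed

lemma card_complement: "card (- S) = CARD('n) - card (S :: 'n::finite set)"
  by (simp add: Compl_eq_Diff_UNIV card_Diff_subset)

lemma dim_row_kernel:
  fixes g :: "complex^'n::finite^'n"
  assumes "det g \<noteq> 0"
  shows "vec.dim (row_kernel g S) = CARD('n) - card S"
proof -
  have "vec.dim (row_kernel g S) = vec.dim ((*v) g ` row_kernel g S)"
    by (rule vec.dim_image_eq[symmetric]) (auto intro: inj_on_subset[OF det_nonzero_inj[OF assms]])
  then show ?thesis
    by (simp add: row_kernel_as_image[OF assms] card_complement)
qed

text \<open>An additive form of the definition, free of truncated subtraction.\<close>

lemma submatrix_rank_add_dim:
  "submatrix_rank g D S + vec.dim (supported_on D \<inter> row_kernel g S) = card D"
  using vec.dim_subset[of "supported_on D \<inter> row_kernel g S" "supported_on D"]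
  by (simp add: submatrix_rank_def)

lemma submatrix_rank_le_columns: "submatrix_rank g D S \<le> card D"
  using submatrix_rank_add_dim[of g D S] by linarith

lemma submatrix_rank_le_rows:
  fixes g :: "complex^'n::finite^'n"
  assumes "det g \<noteq> 0"
  shows "submatrix_rank g D S \<le> card S"
proof -
  have "vec.dim (supported_on D) + vec.dim (row_kernel g S)
      \<le> vec.dim (UNIV :: (complex^'n) set) + vec.dim (supported_on D \<inter> row_kernel g S)"
    by (rule dim_sum_le) auto
  moreover have "vec.dim (UNIV :: (complex^'n) set) = CARD('n)"
    by (simp add: card_cart_basis)
  moreover have "card S \<le> CARD('n)" by (simp add: card_mono)
  ultimately show ?thesis
    using submatrix_rank_add_dim[of g D S] dim_row_kernel[OF assms, of S] by simp
qed

lemma submatrix_rank_mono: "S \<subseteq> S' \<Longrightarrow> submatrix_rank g D S \<le> submatrix_rank g D S'"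
  unfolding submatrix_rank_def row_kernel_def
  by (intro diff_le_mono2 vec.dim_subset) auto

text \<open>The kernels for \<open>S\<close> and \<open>S'\<close> intersect in the kernel for the
  union and both lie in the kernel for the intersection, so the dimension formula gives the reverse
  inequality for kernels.\<close>

lemma submatrix_rank_submodular:
  "submatrix_rank g D (S \<union> S') + submatrix_rank g D (S \<inter> S') \<le> submatrix_rank g D S + submatrix_rank g D S'"
proof -
  let ?K = "\<lambda>S. supported_on D \<inter> row_kernel g S"
  have "vec.dim (?K S) + vec.dim (?K S') \<le> vec.dim (?K (S \<inter> S')) + vec.dim (?K S \<inter> ?K S')"
    by (rule dim_sum_le) (simp_all add: vec.subspace_inter, auto simp: row_kernel_def)
  moreover have "?K S \<inter> ?K S' = ?K (S \<union> S')"
    by (auto simp: row_kernel_def)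
  ultimately show ?thesis
    using submatrix_rank_add_dim[of g D S] submatrix_rank_add_dim[of g D S']
      submatrix_rank_add_dim[of g D "S \<inter> S'"] submatrix_rank_add_dim[of g D "S \<union> S'"] by simp
qed

text \<open>The columns which, restricted to the rows in \<open>S\<close>, do not depend on the columns to their left.\<close>

definition pivots ::
    "complex^'n::{finite,linorder}^'n::{finite,linorder} \<Rightarrow> 'n set \<Rightarrow> 'n set" where
  "pivots g S = {j. \<not> (\<exists>v\<in>row_kernel g S. v$j = 1 \<and> (\<forall>k>j. v$k = 0))}"

text \<open>Pivot columns are linearly independent on the rows \<open>S\<close>: the last nonzero
  coordinate of a relation among them, scaled to 1, would show that its column is not a
  pivot.\<close>

lemma pivots_Int_le_submatrix_rank: "card (pivots g S \<inter> D) \<le> submatrix_rank g D S"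
proof -
  let ?K = "supported_on D \<inter> row_kernel g S" and ?J = "pivots g S"
  have "v = 0" if v: "v \<in> row_kernel g S" "v \<in> supported_on (?J \<inter> D)" for v
  proof (rule ccontr)
    assume "v \<noteq> 0"
    then have ne: "{j. v$j \<noteq> 0} \<noteq> {}" by (auto simp: vec_eq_iff)
    define j where "j = Max {j. v$j \<noteq> 0}"
    have j: "v$j \<noteq> 0" using Max_in[OF _ ne] unfolding j_def by simp
    have gt: "v$k = 0" if "k > j" for k
      using Max_ge[of "{j. v$j \<noteq> 0}" k] that unfolding j_def by fastforce
    have "inverse (v$j) *s v \<in> row_kernel g S"
      using v(1) by (simp add: vec.subspace_scale)
    then have "j \<notin> ?J" using j gt unfolding pivots_def by force
    then show False using v(2) j by (auto simp: supported_on_def)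
  qed
  then have "?K \<inter> supported_on (?J \<inter> D) \<subseteq> {0}" by blast
  then have "vec.dim (?K \<inter> supported_on (?J \<inter> D)) = 0" by simp
  moreover have "vec.dim ?K + vec.dim (supported_on (?J \<inter> D))
      \<le> vec.dim (supported_on D) + vec.dim (?K \<inter> supported_on (?J \<inter> D))"
    by (rule dim_sum_le) (simp_all add: vec.subspace_inter, auto simp: supported_on_def)
  ultimately show ?thesis using submatrix_rank_add_dim[of g D S] by (simp del: vec.dim_eq_0)
qed

text \<open>Each non-pivot column is cleared on the rows \<open>S\<close> by adding multiples of
  columns to its left; these column operations are collected in a unipotent upper triangular
  matrix.\<close>

lemma pivot_reduction:
  fixes g :: "complex^'n::{finite,linorder}^'n::{finite,linorder}"
  obtains u where "u \<in> borel_B" "\<And>i j. i \<in> S \<Longrightarrow> j \<notin> pivots g S \<Longrightarrow> (g ** u)$i$j = 0"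
proof -
  have "\<exists>v. v$j = 1 \<and> (\<forall>k>j. v$k = 0) \<and> (j \<notin> pivots g S \<longrightarrow> v \<in> row_kernel g S)" for j
  proof (cases "j \<in> pivots g S")
    case True
    then show ?thesis by (intro exI[of _ "axis j 1"]) (auto simp: axis_def)
  qed (auto simp: pivots_def)
  then obtain V where V: "\<And>j. V j$j = 1" "\<And>j k. k > j \<Longrightarrow> V j$k = 0"
    "\<And>j. j \<notin> pivots g S \<Longrightarrow> V j \<in> row_kernel g S" by metis
  let ?u = "\<chi> i j. V j$i"
  have "det ?u = 1" using V(1,2) by (subst det_upper_triangular) auto
  then have "?u \<in> borel_B" using V(2) by (auto simp: borel_B_def SL_def)
  moreover have "(g ** ?u)$i$j = (g *v V j)$i" for i j
    by (simp add: matrix_matrix_mult_def matrix_vector_mult_def)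
  ultimately show ?thesis using V(3) that[of ?u] by (auto simp: row_kernel_def)
qed

text \<open>The upper bound is the rank estimate. For the lower bound, the reduced matrix
  \<open>g ** u\<close> annihilates on the rows \<open>S\<close> every vector supported off the
  pivots, and that kernel has dimension \<open>CARD('n) - card S\<close>.\<close>

lemma card_pivots:
  fixes g :: "complex^'n::{finite,linorder}^'n::{finite,linorder}"
  assumes "det g \<noteq> 0"
  shows "card (pivots g S) = card S"
proof (rule antisym)
  have "card (pivots g S \<inter> UNIV) \<le> submatrix_rank g UNIV S" by (rule pivots_Int_le_submatrix_rank)
  then show "card (pivots g S) \<le> card S" using submatrix_rank_le_rows[OF assms, of UNIV S] by simp
  obtain u where u: "u \<in> borel_B" "\<And>i j. i \<in> S \<Longrightarrow> j \<notin> pivots g S \<Longrightarrow> (g ** u)$i$j = 0"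
    using pivot_reduction[of S g] by blast
  have "det (g ** u) \<noteq> 0" using assms u(1) by (simp add: det_mul borel_B_def SL_def)
  moreover have "supported_on (- pivots g S) \<subseteq> row_kernel (g ** u) S"
    using u(2) by (auto simp: supported_on_def row_kernel_def matrix_vector_mult_def intro!: sum.neutral)
      (metis)
  ultimately have "card (- pivots g S) \<le> CARD('n) - card S"
    using vec.dim_subset[of "supported_on (- pivots g S)"] by (metis dim_row_kernel dim_supported_on)
  moreover have "card S \<le> CARD('n)" "card (pivots g S) \<le> CARD('n)" by (simp_all add: card_mono)
  ultimately show "card S \<le> card (pivots g S)" by (simp add: card_complement)
qed

section \<open>Holomorphic functions of matrices\<close>

lemma holomorphic_at_matrix_const: "holomorphic_at_matrix (\<lambda>A. c) x"
  unfolding holomorphic_at_matrix_def by (intro exI[of _ "\<lambda>A. 0"]) auto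

lemma holomorphic_at_matrix_entry:
  "holomorphic_at_matrix (\<lambda>A :: complex^'n::finite^'n. A$i$j) x"
proof -
  have "bounded_linear (\<lambda>A :: complex^'n::finite^'n. A$i$j)"
    by (rule bounded_linear_compose[OF bounded_linear_vec_nth bounded_linear_vec_nth])
  then have "((\<lambda>A :: complex^'n^'n. A$i$j) has_derivative (\<lambda>A. A$i$j)) (at x)"
    by (rule bounded_linear_imp_has_derivative)
  then show ?thesis unfolding holomorphic_at_matrix_def by (intro exI[of _ "\<lambda>A. A$i$j"]) auto
qed

lemma holomorphic_at_matrix_add:
  assumes "holomorphic_at_matrix f x" "holomorphic_at_matrix h x"
  shows "holomorphic_at_matrix (\<lambda>A. f A + h A) x"
proof -
  obtain F H where F: "(f has_derivative F) (at x)" "\<And>c A. F (\<chi> i. c *s A$i) = c * F A"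
    and H: "(h has_derivative H) (at x)" "\<And>c A. H (\<chi> i. c *s A$i) = c * H A"
    using assms unfolding holomorphic_at_matrix_def by blast
  have "((\<lambda>A. f A + h A) has_derivative (\<lambda>A. F A + H A)) (at x)"
    by (rule has_derivative_add[OF F(1) H(1)])
  then show ?thesis unfolding holomorphic_at_matrix_def
    by (intro exI[of _ "\<lambda>A. F A + H A"]) (auto simp: F(2) H(2) algebra_simps)
qed

lemma holomorphic_at_matrix_mult:
  assumes "holomorphic_at_matrix f x" "holomorphic_at_matrix h x"
  shows "holomorphic_at_matrix (\<lambda>A. f A * h A) x"
proof -
  obtain F H where F: "(f has_derivative F) (at x)" "\<And>c A. F (\<chi> i. c *s A$i) = c * F A"
    and H: "(h has_derivative H) (at x)" "\<And>c A. H (\<chi> i. c *s A$i) = c * H A"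
    using assms unfolding holomorphic_at_matrix_def by blast
  have "((\<lambda>A. f A * h A) has_derivative (\<lambda>A. f x * H A + F A * h x)) (at x)"
    by (rule has_derivative_mult[OF F(1) H(1)])
  then show ?thesis unfolding holomorphic_at_matrix_def
    by (intro exI[of _ "\<lambda>A. f x * H A + F A * h x"]) (auto simp: F(2) H(2) algebra_simps)
qed

lemma holomorphic_at_matrix_sum:
  assumes "\<And>i. i \<in> I \<Longrightarrow> holomorphic_at_matrix (f i) x"
  shows "holomorphic_at_matrix (\<lambda>A. \<Sum>i\<in>I. f i A) x"
  using assms
  by (induction I rule: infinite_finite_induct)
    (auto intro: holomorphic_at_matrix_const holomorphic_at_matrix_add)

lemma holomorphic_at_matrix_prod:
  assumes "\<And>i. i \<in> I \<Longrightarrow> holomorphic_at_matrix (f i) x"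
  shows "holomorphic_at_matrix (\<lambda>A. \<Prod>i\<in>I. f i A) x"
  using assms
  by (induction I rule: infinite_finite_induct)
    (auto intro: holomorphic_at_matrix_const holomorphic_at_matrix_mult)

lemma holomorphic_at_matrix_det:
  assumes "\<And>i j. holomorphic_at_matrix (\<lambda>A. M A$i$j) x"
  shows "holomorphic_at_matrix (\<lambda>A. det (M A)) x"
  unfolding det_def
  by (intro holomorphic_at_matrix_sum holomorphic_at_matrix_mult holomorphic_at_matrix_const
      holomorphic_at_matrix_prod assms)

lemma holomorphic_on_submfdI:
  assumes "\<And>x. holomorphic_at_matrix f x" and "\<And>x. x \<in> M \<Longrightarrow> h x = f x"
  shows "holomorphic_on_submfd M h"
  unfolding holomorphic_on_submfd_def using assms
  by (intro ballI exI[of _ UNIV] exI[of _ f]) auto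

text \<open>Continuity is the property of sections and characters on which the degeneration argument
  relies.\<close>

lemma holomorphic_on_submfd_continuous_on:
  assumes "holomorphic_on_submfd M f"
  shows "continuous_on M f"
  unfolding continuous_on_eq_continuous_within
proof
  fix x assume x: "x \<in> M"
  then obtain U h where U: "open U" "x \<in> U" and h: "holomorphic_at_matrix h x"
    and eq: "\<And>y. y \<in> U \<inter> M \<Longrightarrow> h y = f y"
    using assms unfolding holomorphic_on_submfd_def by metis
  from h have "continuous (at x within M) h"
    unfolding holomorphic_at_matrix_def
    by (meson has_derivative_continuous continuous_at_imp_continuous_within)
  moreover have "eventually (\<lambda>y. h y = f y) (at x within M)"
    unfolding eventually_at_topological using U eq by blast
  ultimately show "continuous (at x within M) f"
    unfolding continuous_within using eq[of x] U x
    by (auto elim: Lim_transform_eventually)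
qed

section \<open>Block triangular matrices\<close>

lemma group_SL: "group (SL :: (complex^'n::finite^'n) monoid)"
proof (rule groupI)
  fix A :: "complex^'n^'n" assume A: "A \<in> carrier SL"
  then have "invertible A" by (simp add: SL_def invertible_det_nz)
  then obtain B where "B ** A = mat 1" by (auto simp: invertible_def)
  moreover from this have "det B = 1" using A det_mul[of B A] by (simp add: SL_def)
  ultimately show "\<exists>B\<in>carrier SL. B \<otimes>\<^bsub>SL\<^esub> A = \<one>\<^bsub>SL\<^esub>" by (auto simp: SL_def)
qed (auto simp: SL_def det_mul matrix_mul_assoc)

lemma SL_simps [simp]:
  "A \<in> carrier SL \<longleftrightarrow> det A = 1" "A \<otimes>\<^bsub>SL\<^esub> B = A ** B" "\<one>\<^bsub>SL\<^esub> = mat 1"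
  by (simp_all add: SL_def)

definition elementary :: "'n \<Rightarrow> 'n \<Rightarrow> complex \<Rightarrow> complex^'n::finite^'n" where
  "elementary i j c = (\<chi> k l. if k = l then 1 else if k = i \<and> l = j then c else 0)"

lemma elementary_mult:
  assumes "i \<noteq> j"
  shows "(elementary i j c ** A)$k$l = A$k$l + (if k = i then c * A$j$l else 0)"
proof -
  have "(elementary i j c ** A)$k$l
      = (\<Sum>r\<in>UNIV. (if r = k then A$r$l else 0) + (if r = j then (if k = i then c * A$r$l else 0) else 0))"
    unfolding matrix_matrix_mult_def elementary_def using assms
    by (auto intro!: sum.cong)
  then show ?thesis by (simp add: sum.distrib)
qed

lemma det_elementary:
  assumes "i \<noteq> j"
  shows "det (elementary i j c :: complex^'n::finite^'n) = 1"
proof -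
  have "(elementary i j c :: complex^'n^'n)
      = (\<chi> k. if k = i then row i (mat 1) + c *s row j (mat 1) else row k (mat 1))"
    using assms by (auto simp: vec_eq_iff elementary_def row_def mat_def)
  then show ?thesis using det_row_operation[OF assms, of "mat 1 :: complex^'n^'n" c] by simp
qed

text \<open>For dominant \<open>a\<close> this is the standard parabolic subgroup whose blocks are
  the runs of equal entries of \<open>a\<close>. Comparing entries of \<open>a\<close> instead of
  indices keeps the definition free of an order on the index type.\<close>

definition block_group :: "int^'n::finite \<Rightarrow> (complex^'n^'n) set" where
  "block_group a = {A. det A = 1 \<and> (\<forall>i j. a$i < a$j \<longrightarrow> A$i$j = 0)}"

lemma block_groupD: "A \<in> block_group a \<Longrightarrow> a$i < a$j \<Longrightarrow> A$i$j = 0"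
  by (simp add: block_group_def)

lemma block_group_mult:
  assumes "A \<in> block_group a" "B \<in> block_group a"
  shows "A ** B \<in> block_group a"
proof -
  have "(\<Sum>k\<in>UNIV. A$i$k * B$k$j) = 0" if "a$i < a$j" for i j
  proof (intro sum.neutral ballI)
    fix k show "A$i$k * B$k$j = 0"
      using that assms by (cases "a$i < a$k") (auto simp: block_group_def)
  qed
  moreover have "det (A ** B) = 1" using assms by (simp add: block_group_def det_mul)
  ultimately show ?thesis by (simp add: block_group_def matrix_matrix_mult_def)
qed

lemma elementary_in_block_group:
  "i \<noteq> j \<Longrightarrow> a$j \<le> a$i \<Longrightarrow> elementary i j c \<in> block_group a"
  unfolding block_group_def by (auto simp: det_elementary) (auto simp: elementary_def)

lemma torus_in_block_group: "torus_T \<subseteq> block_group (a :: int^'n::finite)"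
proof
  fix t :: "complex^'n::finite^'n" assume t: "t \<in> torus_T"
  have "i \<noteq> j" if "a$i < a$j" for i j using that by auto
  then show "t \<in> block_group a" using t by (simp add: torus_T_def block_group_def SL_def)
qed

text \<open>Gaussian elimination inside the block triangular group; \<open>C\<close> is the set of columns that
  are already diagonal.\<close>

lemma block_group_induct_columns:
  fixes a :: "int^'n::finite"
  assumes "A \<in> block_group a"
    and "\<And>i j. j \<in> C \<Longrightarrow> i \<noteq> j \<Longrightarrow> A$i$j = 0"
    and "\<And>j k. j \<in> C \<Longrightarrow> a$j < a$k \<Longrightarrow> k \<in> C"
    and torus: "\<And>t. t \<in> torus_T \<Longrightarrow> Q t"
    and elem: "\<And>i j c A. A \<in> block_group a \<Longrightarrow> i \<noteq> j \<Longrightarrow> a$j \<le> a$i \<Longrightarrow>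
      Q (elementary i j c ** A) \<Longrightarrow> Q A"
  shows "Q A"
  using assms(1-3)
proof (induction "card (- C)" arbitrary: A C rule: less_induct)
  case less
  show ?case
  proof (cases "C = UNIV")
    case True
    then have "A \<in> torus_T"
      using less.prems by (auto simp: torus_T_def block_group_def)
    then show ?thesis by (rule torus)
  next
    case False
    then have ne: "(\<lambda>j. a$j) ` (- C) \<noteq> {}" by auto
    \<comment> \<open>Maximality of \<open>a$j\<close> ensures that any row outside \<open>C\<close>
      may be added to row \<open>j\<close> by an elementary matrix of the group.\<close>
    obtain j where j: "j \<notin> C" "a$j = Max ((\<lambda>j. a$j) ` (- C))"
      using Max_in[OF _ ne] by auto
    have max: "a$k \<le> a$j" if "k \<notin> C" for k using that j(2) by simp
    \<comment> \<open>A nonzero diagonal entry allows column \<open>j\<close> to be cleared, by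
      induction on the number of nonzero entries off the diagonal.\<close>
    have clear: "Q A'" if "A' \<in> block_group a" "\<And>i l. l \<in> C \<Longrightarrow> i \<noteq> l \<Longrightarrow> A'$i$l = 0"
      "A'$j$j \<noteq> 0" for A'
      using that
    proof (induction "card {i. i \<noteq> j \<and> A'$i$j \<noteq> 0}" arbitrary: A' rule: less_induct)
      case inner: less
      show ?case
      proof (cases "\<exists>i. i \<noteq> j \<and> A'$i$j \<noteq> 0")
        case False
        have "- insert j C \<subset> - C" using j(1) by auto
        then have "card (- insert j C) < card (- C)" by (simp add: psubset_card_mono)
        then show ?thesis
        proof (rule less.hyps[OF _ inner.prems(1)])
          show "\<And>i l. l \<in> insert j C \<Longrightarrow> i \<noteq> l \<Longrightarrow> A'$i$l = 0"
            using False inner.prems(2) by auto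
          show "\<And>l k. l \<in> insert j C \<Longrightarrow> a$l < a$k \<Longrightarrow> k \<in> insert j C"
            using max less.prems(3) by (metis insert_iff not_le)
        qed
      next
        case True
        then obtain i where i: "i \<noteq> j" "A'$i$j \<noteq> 0" by blast
        then have ij: "a$j \<le> a$i" using inner.prems(1) by (meson block_groupD not_le)
        define c where "c = - A'$i$j / A'$j$j"
        have c: "c * A'$j$j = - A'$i$j" using inner.prems(3) by (simp add: c_def)
        let ?E = "elementary i j c"
        have entry: "(?E ** A')$k$l = A'$k$l + (if k = i then c * A'$j$l else 0)"
          for k l by (rule elementary_mult[OF i(1)])
        have "(?E ** A')$k$j = (if k = i then 0 else A'$k$j)" for k
          by (simp add: entry c)
        then have "{k. k \<noteq> j \<and> (?E ** A')$k$j \<noteq> 0} \<subset> {k. k \<noteq> j \<and> A'$k$j \<noteq> 0}"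
          using i by auto
        then have lt: "card {k. k \<noteq> j \<and> (?E ** A')$k$j \<noteq> 0} < card {k. k \<noteq> j \<and> A'$k$j \<noteq> 0}"
          by (simp add: psubset_card_mono)
        have "Q (?E ** A')"
        proof (rule inner.hyps[OF lt])
          show "?E ** A' \<in> block_group a"
            by (intro block_group_mult elementary_in_block_group inner.prems(1) i(1) ij)
          fix k l assume l: "l \<in> C" "k \<noteq> l"
          then have "A'$j$l = 0" using j(1) by (intro inner.prems(2)) auto
          then show "(?E ** A')$k$l = 0" using inner.prems(2)[OF l] by (simp add: entry)
        next
          show "(?E ** A')$j$j \<noteq> 0" using inner.prems(3) i(1) by (auto simp: entry)
        qed
        then show ?thesis by (rule elem[OF inner.prems(1) i(1) ij])
      qed
    qed
    show ?thesis
    proof (cases "A$j$j = 0")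
      case False
      then show ?thesis using clear less.prems by blast
    next
      case True
      \<comment> \<open>Otherwise all columns in \<open>insert j C\<close> would be supported on the
        rows \<open>C\<close>, which are fewer, contradicting invertibility.\<close>
      have "\<exists>i. i \<notin> C \<and> A$i$j \<noteq> 0"
      proof (rule ccontr)
        assume no: "\<not> ?thesis"
        have "supported_on (insert j C) \<subseteq> row_kernel A (- C)"
        proof
          fix v assume v: "v \<in> supported_on (insert j C)"
          have "A$i$k * v$k = 0" if "i \<notin> C" for i k
            using v no less.prems(2)[of k i] that by (cases "k \<in> insert j C") (auto simp: supported_on_def)
          then show "v \<in> row_kernel A (- C)"
            by (auto simp: row_kernel_def matrix_vector_mult_def intro!: sum.neutral)
        qed
        then have "card (insert j C) \<le> CARD('n) - card (- C)"
          using vec.dim_subset[of "supported_on (insert j C)" "row_kernel A (- C)"]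
            dim_row_kernel[of A "- C"] less.prems(1) by (simp add: block_group_def)
        moreover have "card C \<le> CARD('n)" by (simp add: card_mono)
        ultimately show False using j(1) by (simp add: card_complement)
      qed
      then obtain i where i: "i \<notin> C" "A$i$j \<noteq> 0" by blast
      then have "i \<noteq> j" using True by auto
      have "a$j \<le> a$i" using i less.prems(1) by (meson block_groupD not_le)
      then have ij: "a$i \<le> a$j" "a$j \<le> a$i" using max[OF i(1)] by auto
      \<comment> \<open>Adding row \<open>i\<close> to row \<open>j\<close> creates a nonzero
        diagonal entry, after which \<open>clear\<close> applies.\<close>
      let ?E = "elementary j i 1"
      have entry: "(?E ** A)$k$l = A$k$l + (if k = j then 1 * A$i$l else 0)" for k l
        using \<open>i \<noteq> j\<close> by (intro elementary_mult) auto
      have "Q (?E ** A)"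
      proof (rule clear)
        show "?E ** A \<in> block_group a"
          using \<open>i \<noteq> j\<close> by (intro block_group_mult elementary_in_block_group less.prems(1) ij) auto
        fix k l assume l: "l \<in> C" "k \<noteq> l"
        then have "A$i$l = 0" using i(1) by (intro less.prems(2)) auto
        then show "(?E ** A)$k$l = 0" using less.prems(2)[OF l] by (simp add: entry)
      next
        show "(?E ** A)$j$j \<noteq> 0" using i True by (simp add: entry)
      qed
      then show ?thesis using \<open>i \<noteq> j\<close> by (intro elem[OF less.prems(1) _ ij(1)]) auto
    qed
  qed
qed

lemma block_group_induct [consumes 1, case_names torus elementary]:
  fixes a :: "int^'n::finite"
  assumes "A \<in> block_group a"
    and "\<And>t. t \<in> torus_T \<Longrightarrow> Q t"
    and "\<And>i j c A. A \<in> block_group a \<Longrightarrow> i \<noteq> j \<Longrightarrow> a$j \<le> a$i \<Longrightarrow>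
      Q (elementary i j c ** A) \<Longrightarrow> Q A"
  shows "Q A"
  using block_group_induct_columns[OF assms(1), of "{}" Q] assms(2,3) by blast

lemma diagonal_in_torus:
  "(\<Prod>i\<in>UNIV. d i) = 1 \<Longrightarrow> (\<chi> i j. if i = j then d i else 0) \<in> torus_T"
  by (subst torus_T_def) (simp add: det_diagonal)

lemma diagonal_mult_entry:
  fixes t A :: "complex^'n::finite^'n"
  assumes off: "\<And>k l. k \<noteq> l \<Longrightarrow> t$k$l = 0"
  shows "(t ** A)$i$j = t$i$i * A$i$j" "(A ** t)$i$j = A$i$j * t$j$j"
proof -
  have "(t ** A)$i$j = (\<Sum>k\<in>UNIV. if k = i then t$i$i * A$i$j else 0)"
    unfolding matrix_matrix_mult_def vec_lambda_beta by (rule sum.cong) (use off in auto)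
  then show "(t ** A)$i$j = t$i$i * A$i$j" by simp
  have "(A ** t)$i$j = (\<Sum>k\<in>UNIV. if k = j then A$i$j * t$j$j else 0)"
    unfolding matrix_matrix_mult_def vec_lambda_beta by (rule sum.cong) (use off in auto)
  then show "(A ** t)$i$j = A$i$j * t$j$j" by simp
qed

lemma torus_mult_entry:
  assumes "t \<in> torus_T"
  shows "(t ** A)$i$j = t$i$i * A$i$j" "(A ** t)$i$j = A$i$j * t$j$j"
  using assms by (simp_all add: diagonal_mult_entry torus_T_def)

text \<open>Closure under inverses follows by Gaussian elimination inside the group: the inverse of
  \<open>A\<close> is the inverse of \<open>E ** A\<close> times \<open>E\<close>, and the process
  ends in the torus.\<close>

lemma subgroup_block_group: "subgroup (block_group a) SL"
proof (rule group.subgroupI[OF group_SL])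
  show "block_group a \<subseteq> carrier SL" by (auto simp: block_group_def)
  have "mat 1 \<in> block_group a" by (simp add: block_group_def) (auto simp: mat_def)
  then show "block_group a \<noteq> {}" by blast
  fix A assume A: "A \<in> block_group a"
  interpret SL: group SL by (rule group_SL)
  from A show "inv\<^bsub>SL\<^esub> A \<in> block_group a"
  proof (induction rule: block_group_induct)
    case (torus t)
    have p: "(\<Prod>i\<in>UNIV. t$i$i) = 1" by (rule prod_diagonal_torus[OF torus])
    then have nz: "t$i$i \<noteq> 0" for i by (metis UNIV_I finite prod_zero_iff zero_neq_one)
    let ?s = "\<chi> i j. if i = j then inverse (t$i$i) else 0"
    have s: "?s \<in> torus_T"
      using p by (intro diagonal_in_torus) (simp add: prod_inversef[unfolded o_def])
    have "?s ** t = mat 1"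
      using nz torus by (auto simp: vec_eq_iff torus_mult_entry[OF s] mat_def torus_T_def)
    then have "inv\<^bsub>SL\<^esub> t = ?s"
      using s torus by (intro SL.inv_equality) (auto simp: torus_T_def)
    then show ?case using s torus_in_block_group by auto
  next
    case (elementary i j c A)
    let ?E = "elementary i j c"
    have E: "?E \<in> block_group a" by (rule elementary_in_block_group) fact+
    then have "det ?E = 1" "det A = 1" using elementary(1) by (auto simp: block_group_def)
    then have "inv\<^bsub>SL\<^esub> A = inv\<^bsub>SL\<^esub> (?E ** A) ** ?E"
      using SL.inv_mult_group[of ?E A] SL.m_assoc[of "inv\<^bsub>SL\<^esub> A" "inv\<^bsub>SL\<^esub> ?E" ?E]
        SL.inv_closed[of A]
        SL.inv_closed[of ?E] SL.l_inv[of ?E] by simp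
    then show ?case using block_group_mult[OF elementary(4) E] by simp
  qed
qed (simp add: block_group_mult)

text \<open>Homomorphisms to the multiplicative group are trivial on elementary matrices, so
  elimination reduces the comparison to the torus. This gives uniqueness of extended
  characters.\<close>

lemma block_group_hom_eq:
  assumes "\<phi> \<in> hom (SL\<lparr>carrier := block_group a\<rparr>) Cstar" "\<psi> \<in> hom (SL\<lparr>carrier := block_group a\<rparr>) Cstar"
    and "\<And>t. t \<in> torus_T \<Longrightarrow> \<phi> t = \<psi> t" and "A \<in> block_group a"
  shows "\<phi> A = \<psi> A"
proof -
  have hom: "\<eta> (A ** B) = \<eta> A * \<eta> B" "\<eta> A \<noteq> 0"
    if "\<eta> \<in> hom (SL\<lparr>carrier := block_group a\<rparr>) Cstar" "A \<in> block_group a" "B \<in> block_group a" for \<eta> A B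
    using that by (auto simp: hom_def Cstar_def)
  have elem: "\<eta> (elementary i j c) = 1"
    if \<eta>: "\<eta> \<in> hom (SL\<lparr>carrier := block_group a\<rparr>) Cstar" and ij: "i \<noteq> j" "a$j \<le> a$i" for \<eta> i j c
  proof -
    text \<open>Conjugation by \<open>t\<close> doubles \<open>c\<close>, which amounts to squaring the elementary matrix.\<close>
    let ?E = "elementary i j"
    define t :: "complex^'a^'a" where "t = (\<chi> k l. if k = l then
      (if k = i then of_real (sqrt 2) else if k = j then inverse (of_real (sqrt 2)) else 1) else 0)"
    have "(\<Prod>k\<in>UNIV. if k = i then of_real (sqrt 2) else if k = j then inverse (of_real (sqrt 2)) else 1 :: complex)
        = (\<Prod>k\<in>{i,j}. if k = i then of_real (sqrt 2) else if k = j then inverse (of_real (sqrt 2)) else 1)"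
      by (rule prod.mono_neutral_right) auto
    then have t: "t \<in> torus_T"
      unfolding t_def using ij(1) by (intro diagonal_in_torus) simp
    have E: "?E d \<in> block_group a" for d by (rule elementary_in_block_group[OF ij])
    have tP: "t \<in> block_group a" using t torus_in_block_group by auto
    have sq: "complex_of_real (sqrt 2) * complex_of_real (sqrt 2) = 2"
      by (simp flip: of_real_mult)
    have diag: "t$k$k = (if k = i then of_real (sqrt 2)
        else if k = j then inverse (of_real (sqrt 2)) else 1)" for k
      by (simp add: t_def)
    have "t ** ?E c = ?E (2 * c) ** t"
    proof -
      have "(t ** ?E c)$k$l = (?E (2 * c) ** t)$k$l" for k l
        using sq ij(1) by (auto simp: torus_mult_entry[OF t] elementary_def diag field_simps)
      then show ?thesis by (simp add: vec_eq_iff)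
    qed
    then have "\<eta> t * \<eta> (?E c) = \<eta> (?E (2 * c)) * \<eta> t"
      using hom(1)[OF \<eta>] E tP by metis
    moreover have "?E c ** ?E c = ?E (2 * c)"
    proof -
      have "(?E c ** ?E c)$k$l = ?E (2 * c)$k$l" for k l
        unfolding elementary_mult[OF ij(1)] using ij(1) by (simp add: elementary_def)
      then show ?thesis by (simp add: vec_eq_iff)
    qed
    then have "\<eta> (?E c) * \<eta> (?E c) = \<eta> (?E (2 * c))" using hom(1)[OF \<eta>] E by metis
    \<comment> \<open>In the commutative target, conjugation gives equal values at \<open>c\<close>
      and \<open>2 * c\<close>; so the value at \<open>c\<close> is its own square and, being
      nonzero, equals 1.\<close>
    ultimately show ?thesis using hom(2)[OF \<eta>] E tP by (auto simp: algebra_simps)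
  qed
  from assms(4) show ?thesis
  proof (induction rule: block_group_induct)
    case (torus t)
    then show ?case by (rule assms(3))
  next
    case (elementary i j c A)
    then show ?case
      using hom(1)[OF assms(1) elementary_in_block_group[OF elementary(2,3)]]
        hom(1)[OF assms(2) elementary_in_block_group[OF elementary(2,3)]]
        elem[OF assms(1) elementary(2,3)] elem[OF assms(2) elementary(2,3)] by simp
  qed
qed

section \<open>Minors and characters\<close>

text \<open>Filling the columns outside \<open>D\<close> with standard basis vectors turns a minor
  into a determinant of full size, so that multiplicativity of \<open>det\<close> applies
  directly.\<close>

definition flag_matrix ::
    "'n set \<Rightarrow> ('n \<Rightarrow> 'n) \<Rightarrow> complex^'n::finite^'n \<Rightarrow> complex^'n^'n" where
  "flag_matrix D \<tau> g = (\<chi> i j. if j \<in> D then g$i$j else if i = \<tau> j then 1 else 0)"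

text \<open>Up to sign, the minor of \<open>g\<close> with columns \<open>D\<close> and rows \<open>I\<close>, if \<open>\<tau>\<close> is a bijection from
  the complement of \<open>D\<close> to the complement of \<open>I\<close>.\<close>

definition flag_minor :: "'n set \<Rightarrow> ('n \<Rightarrow> 'n) \<Rightarrow> complex^'n::finite^'n \<Rightarrow> complex" where
  "flag_minor D \<tau> g = det (flag_matrix D \<tau> g)"

lemma holomorphic_flag_minor: "holomorphic_at_matrix (flag_minor D \<tau>) x"
  unfolding flag_minor_def
proof (rule holomorphic_at_matrix_det)
  fix i j show "holomorphic_at_matrix (\<lambda>A. flag_matrix D \<tau> A$i$j) x"
    by (cases "j \<in> D")
      (simp_all add: flag_matrix_def holomorphic_at_matrix_entry holomorphic_at_matrix_const)
qed

text \<open>The hypothesis says that \<open>p\<close> preserves the span of the basis vectors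
  indexed by \<open>D\<close>; then the flag matrix of the product is a product of flag
  matrices.\<close>

lemma flag_minor_mult:
  assumes "\<And>k j. j \<in> D \<Longrightarrow> k \<notin> D \<Longrightarrow> p$k$j = 0"
  shows "flag_minor D \<tau> (g ** p) = flag_minor D \<tau> g * flag_minor D id p"
proof -
  have "flag_matrix D \<tau> (g ** p)$i$j = (flag_matrix D \<tau> g ** flag_matrix D id p)$i$j" for i j
  proof (cases "j \<in> D")
    case True
    then have "flag_matrix D \<tau> (g ** p)$i$j = (\<Sum>k\<in>UNIV. g$i$k * p$k$j)"
      by (simp add: flag_matrix_def matrix_matrix_mult_def)
    also have "\<dots> = (\<Sum>k\<in>UNIV. flag_matrix D \<tau> g$i$k * p$k$j)"
      by (intro sum.cong refl) (auto simp: flag_matrix_def assms[OF True])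
    finally show ?thesis using True by (simp add: flag_matrix_def matrix_matrix_mult_def)
  next
    case False
    have "(\<Sum>k\<in>UNIV. flag_matrix D \<tau> g$i$k * flag_matrix D id p$k$j)
        = (\<Sum>k\<in>UNIV. if k = j then flag_matrix D \<tau> g$i$j else 0)"
      using False by (intro sum.cong) (auto simp: flag_matrix_def)
    then show ?thesis using False by (simp add: flag_matrix_def matrix_matrix_mult_def)
  qed
  then have "flag_matrix D \<tau> (g ** p) = flag_matrix D \<tau> g ** flag_matrix D id p"
    by (simp add: vec_eq_iff)
  then show ?thesis by (simp add: flag_minor_def det_mul)
qed

lemma flag_minor_torus:
  assumes t: "t \<in> torus_T" and \<tau>: "bij_betw \<tau> (- D) (- I)"
  shows "flag_minor D \<tau> (t ** g) = (\<Prod>i\<in>I. t$i$i) * flag_minor D \<tau> g"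
proof -
  \<comment> \<open>\<open>?s\<close> rescales the basis vector columns, which \<open>t\<close>
    multiplies by the entries with index outside \<open>I\<close>. As \<open>det t = 1\<close>, the
    product of those entries is inverse to the product over \<open>I\<close>.\<close>
  let ?s = "\<chi> i j. if i = j then if j \<in> D then 1 else t$(\<tau> j)$(\<tau> j) else 0"
  have "(flag_matrix D \<tau> (t ** g) ** ?s)$i$j = (t ** flag_matrix D \<tau> g)$i$j" for i j
    by (subst diagonal_mult_entry(2)) (auto simp: torus_mult_entry[OF t] flag_matrix_def)
  then have "flag_matrix D \<tau> (t ** g) ** ?s = t ** flag_matrix D \<tau> g"
    by (simp add: vec_eq_iff)
  then have "det (flag_matrix D \<tau> (t ** g) ** ?s) = det (t ** flag_matrix D \<tau> g)"
    by (rule arg_cong)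
  then have 1: "flag_minor D \<tau> (t ** g) * det ?s = flag_minor D \<tau> g"
    using t by (simp add: flag_minor_def det_mul torus_T_def)
  have 2: "det ?s = (\<Prod>i\<in>- I. t$i$i)"
  proof -
    have "det ?s = (\<Prod>j\<in>UNIV. if j \<in> D then 1 else t$(\<tau> j)$(\<tau> j))"
      by (subst det_diagonal) auto
    also have "\<dots> = (\<Prod>j\<in>- D. t$(\<tau> j)$(\<tau> j))"
      by (rule prod.mono_neutral_cong_right) auto
    also have "\<dots> = (\<Prod>i\<in>- I. t$i$i)" by (rule prod.reindex_bij_betw[OF \<tau>])
    finally show ?thesis .
  qed
  have 3: "(\<Prod>i\<in>I. t$i$i) * (\<Prod>i\<in>- I. t$i$i) = 1"
    using prod_diagonal_torus[OF t] prod.union_disjoint[of I "- I" "\<lambda>i. t$i$i"] by simp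
  have "flag_minor D \<tau> (t ** g)
      = flag_minor D \<tau> (t ** g) * ((\<Prod>i\<in>I. t$i$i) * (\<Prod>i\<in>- I. t$i$i))"
    by (simp only: 3 mult_1_right)
  also have "\<dots> = (\<Prod>i\<in>I. t$i$i) * (flag_minor D \<tau> (t ** g) * (\<Prod>i\<in>- I. t$i$i))"
    by (rule mult.left_commute)
  also have "flag_minor D \<tau> (t ** g) * (\<Prod>i\<in>- I. t$i$i) = flag_minor D \<tau> g"
    using 1 2 by simp
  finally show ?thesis .
qed

text \<open>The rows \<open>I\<close> of the flag matrix see only the columns \<open>D\<close>,
  where full column rank makes a kernel vector vanish; the rows \<tau> j then force its remaining
  coordinates to be zero.\<close>

lemma flag_minor_nonzero:
  assumes "submatrix_rank g D I = card D" and \<tau>: "bij_betw \<tau> (- D) (- I)"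
  shows "flag_minor D \<tau> g \<noteq> 0"
proof -
  have zero: "supported_on D \<inter> row_kernel g I \<subseteq> {0}"
    using submatrix_rank_add_dim[of g D I] assms(1) by simp
  have "v = 0" if v: "flag_matrix D \<tau> g *v v = 0" for v
  proof -
    let ?w = "\<chi> j. if j \<in> D then v$j else 0"
    have "(g *v ?w)$i = 0" if "i \<in> I" for i
    proof -
      have "i \<noteq> \<tau> j" if "j \<notin> D" for j
        using \<tau> that \<open>i \<in> I\<close> by (auto simp: bij_betw_def)
      then have "(g *v ?w)$i = (flag_matrix D \<tau> g *v v)$i"
        unfolding matrix_vector_mult_def vec_lambda_beta
        by (intro sum.cong) (auto simp: flag_matrix_def)
      then show ?thesis using v by simp
    qed
    then have "?w \<in> supported_on D \<inter> row_kernel g I"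
      by (auto simp: supported_on_def row_kernel_def)
    then have "?w = 0" using zero by blast
    then have D: "v$j = 0" if "j \<in> D" for j using that by (auto simp: vec_eq_iff split: if_splits)
    have "v$j = 0" if j: "j \<notin> D" for j
    proof -
      have inj: "\<tau> j = \<tau> k \<longleftrightarrow> k = j" if "k \<notin> D" for k
        using \<tau> that j by (auto simp: bij_betw_def inj_on_def)
      have "(flag_matrix D \<tau> g *v v)$\<tau> j = (\<Sum>k\<in>UNIV. if k = j then v$j else 0)"
        unfolding matrix_vector_mult_def vec_lambda_beta
        by (intro sum.cong) (use j in \<open>auto simp: flag_matrix_def D inj\<close>)
      then show ?thesis using v by simp
    qed
    then show ?thesis using D by (auto simp: vec_eq_iff)
  qed
  then have "\<exists>B. B ** flag_matrix D \<tau> g = mat 1"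
    by (simp add: matrix_left_invertible_ker)
  then show ?thesis
    unfolding flag_minor_def by (metis invertible_det_nz invertible_left_inverse)
qed

section \<open>Level sets and the character of the block triangular group\<close>

definition level_set :: "int^'n \<Rightarrow> int \<Rightarrow> 'n set" where
  "level_set a c = {j. c \<le> a$j}"

lemma level_set_count:
  fixes a :: "int^'n::finite"
  assumes "\<And>j. 0 \<le> a$j"
  shows "card {c \<in> {1..\<Sum>i\<in>UNIV. a$i}. j \<in> level_set a c} = nat (a$j)"
proof -
  \<comment> \<open>The total of the entries serves as a common upper bound for the levels; levels
    above the largest entry are empty.\<close>
  have "a$j \<le> (\<Sum>i\<in>UNIV. a$i)" using assms by (intro member_le_sum) auto
  then have "{c \<in> {1..\<Sum>i\<in>UNIV. a$i}. j \<in> level_set a c} = {1..a$j}"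
    by (auto simp: level_set_def)
  then show ?thesis by simp
qed

lemma prod_over_levels:
  fixes I :: "'c \<Rightarrow> 'n::finite set"
  assumes "finite C"
  shows "(\<Prod>c\<in>C. \<Prod>i\<in>I c. x i) = (\<Prod>i\<in>UNIV. x i ^ card {c \<in> C. i \<in> I c})"
proof -
  have "(\<Prod>c\<in>C. \<Prod>i\<in>{i \<in> UNIV. i \<in> I c}. x i) = (\<Prod>i\<in>UNIV. \<Prod>c\<in>{c \<in> C. i \<in> I c}. x i)"
    by (rule prod.swap_restrict[OF assms]) simp
  then show ?thesis by simp
qed

text \<open>For nonnegative \<open>a\<close>, the restriction to \<open>block_group a\<close> is the
  character of weight \<open>a\<close>, written as a product of principal minors, one for each
  level.\<close>

definition block_char :: "int^'n::finite \<Rightarrow> complex^'n^'n \<Rightarrow> complex" where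
  "block_char a p = (\<Prod>c\<in>{1..\<Sum>i\<in>UNIV. a$i}. flag_minor (level_set a c) id p)"

lemma flag_minor_block_mult:
  assumes "p \<in> block_group a"
  shows "flag_minor (level_set a c) \<tau> (g ** p)
    = flag_minor (level_set a c) \<tau> g * flag_minor (level_set a c) id p"
proof (rule flag_minor_mult)
  fix k j assume "j \<in> level_set a c" "k \<notin> level_set a c"
  then have "a$k < a$j" by (simp add: level_set_def)
  then show "p$k$j = 0" by (rule block_groupD[OF assms])
qed

lemma flag_minor_mat_1: "flag_minor D id (mat 1 :: complex^'n::finite^'n) = 1"
proof -
  have "flag_matrix D id (mat 1 :: complex^'n^'n) = mat 1"
    by (auto simp: flag_matrix_def vec_eq_iff mat_def)
  then show ?thesis by (simp add: flag_minor_def)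
qed

lemma block_char_mult:
  "q \<in> block_group a \<Longrightarrow> block_char a (p ** q) = block_char a p * block_char a q"
  unfolding block_char_def flag_minor_block_mult by (rule prod.distrib)

lemma block_char_nonzero:
  assumes "p \<in> block_group a" shows "block_char a p \<noteq> 0"
proof -
  interpret SL: group SL by (rule group_SL)
  have "inv\<^bsub>SL\<^esub> p \<in> block_group a"
    using subgroup.m_inv_closed[OF subgroup_block_group assms] .
  then have "block_char a p * block_char a (inv\<^bsub>SL\<^esub> p) = block_char a (p ** inv\<^bsub>SL\<^esub> p)"
    by (simp add: block_char_mult)
  also have "p ** inv\<^bsub>SL\<^esub> p = mat 1"
    using SL.r_inv[of p] assms by (simp add: block_group_def)
  also have "block_char a (mat 1) = 1" by (simp add: block_char_def flag_minor_mat_1)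
  finally show ?thesis by auto
qed

lemma block_char_torus:
  assumes "\<And>j. 0 \<le> a$j" "t \<in> torus_T"
  shows "block_char a t = (\<Prod>i\<in>UNIV. t$i$i ^ nat (a$i))"
proof -
  have "flag_minor D id t = (\<Prod>i\<in>D. t$i$i)" for D
    using flag_minor_torus[OF assms(2), of id D D "mat 1"] by (simp add: flag_minor_mat_1)
  then show ?thesis
    by (simp only: block_char_def prod_over_levels[OF finite_atLeastAtMost_int]
        level_set_count[OF assms(1)])
qed

lemma torus_char_weight_of:
  "t \<in> torus_T \<Longrightarrow> torus_char (weight_of a) t = (\<Prod>i\<in>UNIV. (t$i$i) powi (a$i))"
  unfolding torus_char.abs_eq by (rule restrict_apply')

lemma torus_char_nmult:
  assumes "t \<in> torus_T"
  shows "torus_char (nmult N \<nu>) t = torus_char \<nu> t ^ N"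
proof (induction \<nu> rule: weight.abs_induct)
  case (1 a)
  have "x powi (int N * k) = (x powi k) ^ N" for x :: complex and k
    unfolding power_int_power' by (simp only: mult.commute)
  then show ?case
    by (simp add: nmult.abs_eq torus_char_weight_of assms prod_power_distrib)
qed

text \<open>\<open>N = 1\<close> serves the line bundle itself, general \<open>N\<close> its tensor
  powers.\<close>

lemma extends_to_block_char_power:
  assumes "\<And>j. 0 \<le> a$j"
  shows "extends_to (nmult N (weight_of a)) (block_group a) (\<lambda>p. block_char a p ^ N)"
  unfolding extends_to_def
proof (intro conjI ballI)
  show "(\<lambda>p. block_char a p ^ N) \<in> hom (SL\<lparr>carrier := block_group a\<rparr>) Cstar"
    by (auto simp: hom_def Cstar_def block_char_nonzero block_char_mult power_mult_distrib)
  \<comment> \<open>The power is written as a product so that closure of holomorphy under products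
    applies.\<close>
  have "holomorphic_at_matrix (\<lambda>p. \<Prod>k\<in>{..<N}. block_char a p) x" for x
    unfolding block_char_def by (intro holomorphic_at_matrix_prod holomorphic_flag_minor)
  then show "holomorphic_on_submfd (block_group a) (\<lambda>p. block_char a p ^ N)"
    by (intro holomorphic_on_submfdI) simp_all
  fix t :: "complex^'a^'a" assume t: "t \<in> torus_T"
  have "block_char a t = torus_char (weight_of a) t"
    using assms by (simp add: block_char_torus t torus_char_weight_of power_int_def)
  then show "block_char a t ^ N = torus_char (nmult N (weight_of a)) t"
    by (simp add: torus_char_nmult t)
qed

text \<open>Extensions agree on the group by \<open>block_group_hom_eq\<close>, so the definite
  description denotes the restriction of \<psi>.\<close>

lemma ext_char_eq:
  assumes \<psi>: "extends_to \<nu> (block_group a) \<psi>" and p: "p \<in> block_group a"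
  shows "ext_char (block_group a) \<nu> p = \<psi> p"
proof -
  let ?r = "restrict \<psi> (block_group a)"
  have "extends_to \<nu> (block_group a) ?r"
    unfolding extends_to_def
  proof (intro conjI ballI)
    show "?r \<in> hom (SL\<lparr>carrier := block_group a\<rparr>) Cstar"
      using \<psi> by (auto simp: extends_to_def hom_def block_group_mult)
    show "holomorphic_on_submfd (block_group a) ?r"
      using \<psi> unfolding extends_to_def holomorphic_on_submfd_def by fastforce
    show "?r t = torus_char \<nu> t" if "t \<in> torus_T" for t
      using \<psi> that torus_in_block_group[of a] by (auto simp: extends_to_def)
  qed
  moreover have "\<phi> = ?r" if "\<phi> \<in> extensional (block_group a)" "extends_to \<nu> (block_group a) \<phi>" for \<phi>
  proof (rule extensionalityI[OF that(1) restrict_extensional])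
    fix q assume q: "q \<in> block_group a"
    have "\<phi> q = \<psi> q"
      by (rule block_group_hom_eq[OF _ _ _ q]) (use \<psi> that in \<open>auto simp: extends_to_def\<close>)
    then show "\<phi> q = ?r q" using q by simp
  qed
  ultimately have "ext_char (block_group a) \<nu> = ?r"
    unfolding ext_char_def by (intro the_equality) auto
  then show ?thesis using p by simp
qed

section \<open>Degenerations along one-parameter subgroups\<close>

lemma prod_power_int:
  fixes z :: complex
  assumes "z \<noteq> 0"
  shows "(\<Prod>i\<in>I. z powi e i) = z powi (\<Sum>i\<in>I. e i)"
  by (induction I rule: infinite_finite_induct) (simp_all add: assms power_int_add)

text \<open>The exponents are shifted by \<open>card S\<close> so that the determinant is 1.\<close>

definition cochar :: "'n set \<Rightarrow> complex \<Rightarrow> complex^'n::finite^'n" where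
  "cochar S z = (\<chi> i j. if i = j
     then z powi ((if i \<in> S then int CARD('n) else 0) - int (card S)) else 0)"

text \<open>The pairing of the one-parameter subgroup \<open>cochar S\<close> with the weight
  \<open>v\<close>.\<close>

lemma sum_cochar_weights:
  fixes v :: "int^'n::finite"
  shows "(\<Sum>i\<in>UNIV. ((if i \<in> S then int CARD('n) else 0) - int (card S)) * v$i)
    = int CARD('n) * (\<Sum>i\<in>S. v$i) - int (card S) * (\<Sum>i\<in>UNIV. v$i)"
proof -
  have "(\<Sum>i\<in>UNIV. ((if i \<in> S then int CARD('n) else 0) - int (card S)) * v$i)
      = (\<Sum>i\<in>UNIV. (if i \<in> S then int CARD('n) * v$i else 0) - int (card S) * v$i)"
    by (intro sum.cong) (auto simp: algebra_simps)
  also have "\<dots> = (\<Sum>i\<in>UNIV. if i \<in> S then int CARD('n) * v$i else 0) - int (card S) * (\<Sum>i\<in>UNIV. v$i)"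
    by (simp only: sum_subtractf sum_distrib_left)
  also have "(\<Sum>i\<in>UNIV. if i \<in> S then int CARD('n) * v$i else 0) = int CARD('n) * (\<Sum>i\<in>S. v$i)"
    by (simp add: sum.If_cases sum_distrib_left)
  finally show ?thesis .
qed

lemma cochar_in_torus:
  fixes S :: "'n::finite set"
  assumes "z \<noteq> 0" shows "(cochar S z :: complex^'n^'n) \<in> torus_T"
  unfolding cochar_def
proof (rule diagonal_in_torus)
  show "(\<Prod>i\<in>UNIV. z powi ((if i \<in> S then int CARD('n) else 0) - int (card S))) = 1"
    using sum_cochar_weights[of S "\<chi> i. 1"] by (simp add: prod_power_int[OF assms])
qed

lemma torus_char_cochar:
  fixes v :: "int^'n::finite"
  assumes "z \<noteq> 0"
  shows "torus_char (weight_of v) (cochar S z)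
    = z powi (int CARD('n) * (\<Sum>i\<in>S. v$i) - int (card S) * (\<Sum>i\<in>UNIV. v$i))"
proof -
  have "torus_char (weight_of v) (cochar S z)
      = (\<Prod>i\<in>UNIV. z powi (((if i \<in> S then int CARD('n) else 0) - int (card S)) * v$i))"
    by (subst torus_char_weight_of[OF cochar_in_torus[OF assms]])
      (simp add: cochar_def power_int_mult)
  then show ?thesis by (simp only: prod_power_int[OF assms] sum_cochar_weights)
qed

text \<open>Equal cardinalities cancel the shifts, so the entry at \<open>i\<close>,
  \<open>j\<close> is scaled by \<open>z\<close> to the power \<open>CARD('n)\<close>, 0 or
  \<open>- CARD('n)\<close>. The negative power occurs only for \<open>i \<in> S\<close>,
  \<open>j \<notin> J\<close>, where \<open>A\<close> vanishes; the positive one tends to 0.\<close>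

lemma cochar_degeneration:
  fixes A :: "complex^'n::finite^'n"
  assumes "card J = card S" and zero: "\<And>i j. i \<in> S \<Longrightarrow> j \<notin> J \<Longrightarrow> A$i$j = 0"
  shows "((\<lambda>z. cochar S (inverse z) ** A ** cochar J z) \<longlongrightarrow>
    (\<chi> i j. if i \<in> S \<longleftrightarrow> j \<in> J then A$i$j else 0)) (at 0)"
proof (rule vec_tendstoI, rule vec_tendstoI)
  fix i j :: 'n
  let ?lim = "(\<chi> i j. if i \<in> S \<longleftrightarrow> j \<in> J then A$i$j else 0)$i$j"
  let ?e = "(if j \<in> J then int CARD('n) else 0) - (if i \<in> S then int CARD('n) else 0)"
  let ?s = "(if i \<in> S then int CARD('n) else 0) - int (card S)"
    and ?t = "(if j \<in> J then int CARD('n) else 0) - int (card J)"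
  have "(cochar S (inverse z) ** A ** cochar J z)$i$j = A$i$j * z powi ?e" if z: "z \<noteq> 0" for z
  proof -
    have t: "(cochar S (inverse z) :: complex^'n^'n) \<in> torus_T" "(cochar J z :: complex^'n^'n) \<in> torus_T"
      using z by (auto intro: cochar_in_torus)
    have "(cochar S (inverse z) ** A ** cochar J z)$i$j = inverse z powi ?s * A$i$j * z powi ?t"
      unfolding torus_mult_entry(2)[OF t(2)] torus_mult_entry(1)[OF t(1)] by (simp add: cochar_def)
    also have "\<dots> = A$i$j * (z powi (- ?s) * z powi ?t)"
      by (simp only: power_int_inverse power_int_minus mult_ac)
    also have "z powi (- ?s) * z powi ?t = z powi (- ?s + ?t)"
      by (rule power_int_add[symmetric]) (simp add: z)
    also have "- ?s + ?t = ?e" using assms(1) by simp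
    finally show ?thesis .
  qed
  then have ev: "\<forall>\<^sub>F z in at 0. (cochar S (inverse z) ** A ** cochar J z)$i$j = A$i$j * z powi ?e"
    by (auto simp: eventually_at_filter)
  have "((\<lambda>z. A$i$j * z powi ?e) \<longlongrightarrow> ?lim) (at 0)"
  proof (cases "i \<in> S \<longleftrightarrow> j \<in> J")
    case True then show ?thesis by auto
  next
    case False
    show ?thesis
    proof (cases "i \<in> S")
      case True
      then show ?thesis using False zero by simp
    next
      case i: False
      have "((\<lambda>z. A$i$j * z ^ CARD('n)) \<longlongrightarrow> A$i$j * 0 ^ CARD('n)) (at 0)"
        by (intro tendsto_intros)
      then show ?thesis using False i by (simp add: power_0_left)
    qed
  qed
  then show "((\<lambda>z. (cochar S (inverse z) ** A ** cochar J z)$i$j) \<longlongrightarrow> ?lim) (at 0)"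
    by (rule Lim_transform_eventually) (use ev in \<open>auto elim: eventually_mono\<close>)
qed

lemma power_int_limit_at_0:
  fixes K l :: complex
  assumes "((\<lambda>z. K * z powi e) \<longlongrightarrow> l) (at 0)" "K \<noteq> 0"
  shows "0 \<le> e" "l \<noteq> 0 \<Longrightarrow> e = 0"
proof -
  show "0 \<le> e"
  proof (rule ccontr)
    assume "\<not> 0 \<le> e"
    then have "e = - int (nat (- e))" "nat (- e) \<noteq> 0" by auto
    then obtain k where e: "e = - int k" "k \<noteq> 0" by blast
    \<comment> \<open>Multiplication by \<open>z ^ k\<close> makes the function constantly
      \<open>K\<close> near 0, while its limit becomes 0.\<close>
    have "((\<lambda>z. K * z powi e * z ^ k) \<longlongrightarrow> l * 0 ^ k) (at 0)"
      by (intro tendsto_intros assms(1))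
    moreover have "\<forall>\<^sub>F z in at 0. K * z powi e * z ^ k = K"
    proof -
      have "K * z powi e * z ^ k = K" if "z \<noteq> 0" for z
        using that by (simp add: e(1) power_int_minus)
      then show ?thesis by (rule eventually_mono[OF eventually_neq_at_within])
    qed
    ultimately have "((\<lambda>z::complex. K) \<longlongrightarrow> l * 0 ^ k) (at 0)"
      by (rule Lim_transform_eventually)
    then have "K = l * 0 ^ k" by (simp add: tendsto_const_iff)
    then show False using assms(2) e(2) by (simp add: power_0_left)
  qed
  assume "l \<noteq> 0"
  show "e = 0"
  proof (rule ccontr)
    assume "e \<noteq> 0"
    then have e: "e = int (nat e)" "nat e \<noteq> 0" using \<open>0 \<le> e\<close> by auto
    have "((\<lambda>z. K * z ^ nat e) \<longlongrightarrow> K * 0 ^ nat e) (at 0)" by (intro tendsto_intros)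
    moreover have "((\<lambda>z. K * z ^ nat e) \<longlongrightarrow> l) (at 0)"
      using assms(1) e(1) by (metis (no_types, lifting) ext power_int_of_nat)
    ultimately have "l = K * 0 ^ nat e" by (metis LIM_unique)
    then show False using \<open>l \<noteq> 0\<close> e(2) by (simp add: power_0_left)
  qed
qed

text \<open>A common form of two applications: a semi-invariant function on SL(n,C), and a character
  of a closed subgroup. Closedness of \<open>M\<close> keeps the limit point in \<open>M\<close>; a
  finite limit excludes a negative exponent, a nonzero limit also a positive one.\<close>

lemma equivariant_exponent:
  fixes F :: "complex^'n::{finite,linorder}^'n::{finite,linorder} \<Rightarrow> complex"
  assumes "continuous_on M F" "closed M" "M \<subseteq> carrier SL" "g \<in> M"
    and left: "\<And>t A. t \<in> torus_T \<Longrightarrow> A \<in> M \<Longrightarrow>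
      t ** A \<in> M \<and> F (t ** A) = torus_char (weight_of m) t * F A"
    and right: "\<And>t A. t \<in> torus_T \<Longrightarrow> A \<in> M \<Longrightarrow>
      A ** t \<in> M \<and> F (A ** t) = torus_char (weight_of a) t * F A"
    and borel: "\<And>b. b \<in> borel_B \<Longrightarrow> g ** b \<in> M \<and> F (g ** b) \<noteq> 0"
    and sum: "(\<Sum>i\<in>UNIV. m$i) = (\<Sum>i\<in>UNIV. a$i)"
  shows "(\<Sum>i\<in>S. m$i) \<le> (\<Sum>j\<in>pivots g S. a$j)"
    and "(\<And>A. A \<in> M \<Longrightarrow> F A \<noteq> 0) \<Longrightarrow> (\<Sum>i\<in>S. m$i) = (\<Sum>j\<in>pivots g S. a$j)"
proof -
  let ?J = "pivots g S"
  let ?E = "int CARD('n) * ((\<Sum>j\<in>?J. a$j) - (\<Sum>i\<in>S. m$i))"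
  have card: "card ?J = card S" using assms(3,4) by (intro card_pivots) auto
  obtain u where u: "u \<in> borel_B" "\<And>i j. i \<in> S \<Longrightarrow> j \<notin> ?J \<Longrightarrow> (g ** u)$i$j = 0"
    using pivot_reduction[of S g] by blast
  define h where "h = (\<chi> i j. if i \<in> S \<longleftrightarrow> j \<in> ?J then (g ** u)$i$j else 0)"
  let ?c = "\<lambda>z. cochar S (inverse z) ** (g ** u) ** cochar ?J z"
  have lim: "(?c \<longlongrightarrow> h) (at 0)"
    unfolding h_def by (rule cochar_degeneration[OF card u(2)])
  have c: "?c z \<in> M \<and> F (?c z) = F (g ** u) * z powi ?E" if z: "z \<noteq> 0" for z
  proof -
    have t: "(cochar S (inverse z) :: complex^'n::{finite,linorder}^'n::{finite,linorder}) \<in> torus_T" "(cochar ?J z :: complex^'n::{finite,linorder}^'n::{finite,linorder}) \<in> torus_T"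
      using z by (auto intro: cochar_in_torus)
    have 1: "cochar S (inverse z) ** (g ** u) \<in> M"
      "F (cochar S (inverse z) ** (g ** u)) = torus_char (weight_of m) (cochar S (inverse z)) * F (g ** u)"
      using left[OF t(1)] borel[OF u(1)] by blast+
    \<comment> \<open>Equal cardinalities and equal coordinate sums cancel the shift terms of the
      two cocharacters.\<close>
    have "torus_char (weight_of a) (cochar ?J z) * torus_char (weight_of m) (cochar S (inverse z)) = z powi ?E"
      using z card sum
      by (simp add: torus_char_cochar power_int_inverse power_int_minus[symmetric]
          power_int_add[symmetric] algebra_simps flip: power_int_minus)
    then show ?thesis using right[OF t(2) 1(1)] 1(2) by simp
  qed
  then have inM: "\<forall>\<^sub>F z in at 0. ?c z \<in> M" by (auto simp: eventually_at_filter)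
  have hM: "h \<in> M"
    by (rule Lim_in_closed_set[OF assms(2) inM _ lim]) simp
  have "((\<lambda>z. F (?c z)) \<longlongrightarrow> F h) (at 0)"
    by (rule continuous_on_tendsto_compose[OF assms(1) lim hM inM])
  moreover have "\<forall>\<^sub>F z in at 0. F (?c z) = F (g ** u) * z powi ?E"
    using c by (auto simp: eventually_at_filter)
  ultimately have lim': "((\<lambda>z. F (g ** u) * z powi ?E) \<longlongrightarrow> F h) (at 0)"
    by (rule Lim_transform_eventually)
  have nz: "F (g ** u) \<noteq> 0" using borel[OF u(1)] by blast
  show "(\<Sum>i\<in>S. m$i) \<le> (\<Sum>j\<in>?J. a$j)"
    using power_int_limit_at_0(1)[OF lim' nz] by (simp add: zero_le_mult_iff)
  assume "\<And>A. A \<in> M \<Longrightarrow> F A \<noteq> 0"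
  then show "(\<Sum>i\<in>S. m$i) = (\<Sum>j\<in>?J. a$j)"
    using power_int_limit_at_0(2)[OF lim' nz] hM by simp
qed

section \<open>The largest parabolic subgroup\<close>

lemma closed_SL: "closed (carrier SL :: (complex^'n::finite^'n) set)"
proof -
  have "holomorphic_on_submfd UNIV (det :: complex^'n^'n \<Rightarrow> complex)"
    by (rule holomorphic_on_submfdI[of det])
      (auto intro!: holomorphic_at_matrix_det[of "\<lambda>A. A"] holomorphic_at_matrix_entry)
  then have "continuous_on UNIV (det :: complex^'n^'n \<Rightarrow> complex)"
    by (rule holomorphic_on_submfd_continuous_on)
  then have "closed (det -` {1 :: complex} :: (complex^'n^'n) set)"
    by (simp add: continuous_on_closed_vimage)
  moreover have "carrier SL = (det -` {1} :: (complex^'n^'n) set)" by auto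
  ultimately show ?thesis by simp
qed

lemma closed_block_group: "closed (block_group a)"
proof -
  have "closed {A :: complex^'a^'a. A$i$j = 0}" for i j
    by (intro closed_Collect_eq continuous_intros)
  then have "closed (carrier SL \<inter> (\<Inter>(i,j)\<in>{(i,j). a$i < a$j}. {A. A$i$j = 0}))"
    by (intro closed_Int closed_SL closed_INT) auto
  moreover have "block_group a = carrier SL \<inter> (\<Inter>(i,j)\<in>{(i,j). a$i < a$j}. {A. A$i$j = 0})"
    by (auto simp: block_group_def)
  ultimately show ?thesis by simp
qed

lemma dominant_weight_of:
  "dominant (weight_of a) \<longleftrightarrow> (\<forall>i j. i \<le> j \<longrightarrow> a$j \<le> a$i)"
  by (simp add: dominant.abs_eq)

lemma borel_in_block_group:
  assumes "dominant (weight_of a)" shows "borel_B \<subseteq> block_group a"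
proof
  fix b :: "complex^'a::{finite,linorder}^'a::{finite,linorder}" assume b: "b \<in> borel_B"
  have "j < i" if "a$i < a$j" for i j
    using assms that by (metis dominant_weight_of not_le)
  then show "b \<in> block_group a" using b by (auto simp: borel_B_def block_group_def)
qed

lemma torus_in_borel: "torus_T \<subseteq> borel_B"
  by (auto simp: torus_T_def borel_B_def)

text \<open>A character has no zeros, so the degeneration with \<open>m = a\<close> gives
  equalities. Applied to a single row, they locate its first nonzero entry in a column of the same
  block.\<close>

lemma extending_subgroup_in_block_group:
  assumes dom: "dominant (weight_of a)"
    and P: "subgroup P SL" "closed P" "borel_B \<subseteq> P" and \<psi>: "extends_to (weight_of a) P \<psi>"
  shows "P \<subseteq> block_group a"
proof
  fix p assume p: "p \<in> P"
  have hom: "\<psi> (A ** B) = \<psi> A * \<psi> B" "\<psi> A \<noteq> 0" if "A \<in> P" "B \<in> P" for A B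
    using that \<psi> by (auto simp: extends_to_def hom_def Cstar_def)
  have mult: "A ** B \<in> P" if "A \<in> P" "B \<in> P" for A B
    using subgroup.m_closed[OF P(1) that] by simp
  have torus: "t \<in> P" "\<psi> t = torus_char (weight_of a) t" if "t \<in> torus_T" for t
    using that torus_in_borel P(3) \<psi> by (auto simp: extends_to_def)
  have sub: "P \<subseteq> carrier SL" using subgroup.subset[OF P(1)] .
  have eq: "(\<Sum>i\<in>S. a$i) = (\<Sum>j\<in>pivots p S. a$j)" for S
  proof (rule equivariant_exponent(2)[OF _ P(2) sub p])
    show "continuous_on P \<psi>"
      using \<psi> by (intro holomorphic_on_submfd_continuous_on) (simp add: extends_to_def)
  qed (use P(3) p in \<open>auto simp: hom torus mult\<close>)
  have "p$i$j = 0" if "a$i < a$j" for i j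
  proof (rule ccontr)
    assume nz: "p$i$j \<noteq> 0"
    \<comment> \<open>The leftmost nonzero entry of row \<open>i\<close> is its only pivot.\<close>
    define k where "k = Min {k. p$i$k \<noteq> 0}"
    have k: "p$i$k \<noteq> 0" "k \<le> j"
      using Min_in[of "{k. p$i$k \<noteq> 0}"] nz unfolding k_def by auto
    have lt: "p$i$l = 0" if "l < k" for l
      using Min_le[of "{k. p$i$k \<noteq> 0}" l] that unfolding k_def by fastforce
    have "k \<in> pivots p {i}"
    proof (rule ccontr)
      assume "k \<notin> pivots p {i}"
      then obtain v where v: "(p *v v)$i = 0" "v$k = 1" "\<And>l. l > k \<Longrightarrow> v$l = 0"
        by (auto simp: pivots_def row_kernel_def)
      have "(p *v v)$i = (\<Sum>l\<in>UNIV. if l = k then p$i$k else 0)"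
        unfolding matrix_vector_mult_def vec_lambda_beta
      proof (rule sum.cong)
        fix l show "p$i$l * v$l = (if l = k then p$i$k else 0)"
          using v lt by (cases l k rule: linorder_cases) auto
      qed simp
      then show False using v(1) k(1) by simp
    qed
    moreover have "card (pivots p {i}) = 1" using p sub by (subst card_pivots) auto
    ultimately have "pivots p {i} = {k}" by (auto simp: card_1_singleton_iff)
    then have "a$i = a$k" using eq[of "{i}"] by simp
    moreover have "a$j \<le> a$k" using dom k(2) by (simp add: dominant_weight_of)
    ultimately show False using that by simp
  qed
  then show "p \<in> block_group a" using p sub by (auto simp: block_group_def)
qed

text \<open>\<open>block_char\<close> provides the extension, and the degeneration argument excludes
  larger subgroups.\<close>

lemma P_of_eq_block_group:
  assumes "dominant (weight_of a)" "\<And>j. 0 \<le> a$j"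
  shows "P_of (weight_of a) = block_group a"
  unfolding P_of_def
proof (rule Greatest_equality)
  have "nmult 1 (weight_of a) = weight_of a" by (simp add: nmult.abs_eq)
  then have "extends_to (weight_of a) (block_group a) (\<lambda>p. block_char a p ^ 1)"
    using extends_to_block_char_power[OF assms(2), where N = 1] by metis
  moreover have "parabolic (block_group a)"
    unfolding parabolic_def
  proof (intro conjI subgroup_block_group closed_block_group bexI[of _ "mat 1"])
    interpret SL: group SL by (rule group_SL)
    have "inv\<^bsub>SL\<^esub> (mat 1 :: complex^'a::{finite,linorder}^'a::{finite,linorder}) = mat 1" using SL.inv_one by simp
    then show "(mat 1 <#\<^bsub>SL\<^esub> borel_B) #>\<^bsub>SL\<^esub> (inv\<^bsub>SL\<^esub> (mat 1)) \<subseteq> block_group a"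
      using borel_in_block_group[OF assms(1)] by (auto simp: l_coset_def r_coset_def)
  qed simp
  ultimately show "parabolic (block_group a) \<and> borel_B \<subseteq> block_group a \<and>
      (\<exists>\<psi>. extends_to (weight_of a) (block_group a) \<psi>)"
    using borel_in_block_group[OF assms(1)] by blast
qed (auto simp: parabolic_def dest!: extending_subgroup_in_block_group[OF assms(1)])

section \<open>Sections as functions\<close>

lemma l_coset_SL: "g <#\<^bsub>SL\<^esub> P = (**) g ` P"
  by (auto simp: l_coset_def)

lemma l_coset_SL_assoc: "t <#\<^bsub>SL\<^esub> (g <#\<^bsub>SL\<^esub> P) = (t ** g) <#\<^bsub>SL\<^esub> P"
  by (simp add: l_coset_SL image_image matrix_mul_assoc)

text \<open>The graph of \<open>f\<close> over the coset \<open>x\<close>, which is the class of \<open>(g, f g)\<close> for every \<open>g \<in> x\<close>.\<close>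

abbreviation graph_over ::
    "(complex^'n::finite^'n \<Rightarrow> complex) \<Rightarrow> (complex^'n^'n) set \<Rightarrow> ((complex^'n^'n) \<times> complex) set" where
  "graph_over f x \<equiv> (\<lambda>h. (h, f h)) ` x"

lemma bundle_class_eq_graph:
  assumes "g \<in> carrier SL" "\<And>p. p \<in> P \<Longrightarrow> f (g ** p) = ext_char P \<nu> p * f g"
  shows "bundle_rel P \<nu> `` {(g, f g)} = graph_over f (g <#\<^bsub>SL\<^esub> P)"
proof -
  have "bundle_rel P \<nu> `` {(g, f g)} = (\<lambda>p. (g ** p, ext_char P \<nu> p * f g)) ` P"
    using assms(1) by (auto simp: bundle_rel_def)
  also have "\<dots> = (\<lambda>p. (g ** p, f (g ** p))) ` P"
    using assms(2) by (intro image_cong) auto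
  finally show ?thesis by (simp add: l_coset_SL image_image)
qed

text \<open>Describing a section by graphs over cosets removes the choice of representatives, so
  invariance and vanishing can be read off from \<open>f\<close>.\<close>

lemma global_sectionsE:
  assumes "s \<in> global_sections P \<nu>"
  obtains f where "holomorphic_on_submfd (carrier SL) f"
    "\<And>g p. g \<in> carrier SL \<Longrightarrow> p \<in> P \<Longrightarrow> f (g ** p) = ext_char P \<nu> p * f g"
    "\<And>x. x \<in> lcosets\<^bsub>SL\<^esub> P \<Longrightarrow> s x = graph_over f x"
proof -
  obtain f where hol: "holomorphic_on_submfd (carrier SL) f"
    and eq: "\<forall>g\<in>carrier SL. \<forall>p\<in>P. f (g ** p) = ext_char P \<nu> p * f g"
    and s: "\<forall>g\<in>carrier SL. s (g <#\<^bsub>SL\<^esub> P) = bundle_rel P \<nu> `` {(g, f g)}"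
    using assms unfolding global_sections_def mem_Collect_eq by (elim conjE exE)
  show thesis
  proof
    show "holomorphic_on_submfd (carrier SL) f" by (rule hol)
    show "f (g ** p) = ext_char P \<nu> p * f g" if "g \<in> carrier SL" "p \<in> P" for g p
      using eq that by blast
    fix x assume x: "x \<in> lcosets\<^bsub>SL\<^esub> P"
    obtain g where g: "g \<in> carrier SL" "x = g <#\<^bsub>SL\<^esub> P"
      using x unfolding LCOSETS_def by blast
    have "s x = bundle_rel P \<nu> `` {(g, f g)}" unfolding g(2) using s g(1) by (rule bspec)
    also have "\<dots> = graph_over f x"
      unfolding g(2) by (rule bundle_class_eq_graph[OF g(1)]) (rule bspec[OF bspec[OF eq g(1)]])
    finally show "s x = graph_over f x" .
  qed
qed

lemma global_sectionsI:
  assumes "s \<in> extensional (lcosets\<^bsub>SL\<^esub> P)" "holomorphic_on_submfd (carrier SL) f"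
    and eq: "\<And>g p. g \<in> carrier SL \<Longrightarrow> p \<in> P \<Longrightarrow> f (g ** p) = ext_char P \<nu> p * f g"
    and s: "\<And>x. x \<in> lcosets\<^bsub>SL\<^esub> P \<Longrightarrow> s x = graph_over f x"
  shows "s \<in> global_sections P \<nu>"
proof -
  have fibre: "s (g <#\<^bsub>SL\<^esub> P) = bundle_rel P \<nu> `` {(g, f g)}" if g: "g \<in> carrier SL" for g
  proof -
    have "g <#\<^bsub>SL\<^esub> P \<in> lcosets\<^bsub>SL\<^esub> P" using g unfolding LCOSETS_def by blast
    then show ?thesis using s bundle_class_eq_graph[OF g eq[OF g]] by simp
  qed
  have "s x \<in> line_bundle P \<nu>" if x: "x \<in> lcosets\<^bsub>SL\<^esub> P" for x
  proof -
    obtain g where g: "g \<in> carrier SL" "x = g <#\<^bsub>SL\<^esub> P"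
      using x unfolding LCOSETS_def by blast
    show ?thesis
      unfolding g(2) fibre[OF g(1)] line_bundle_def by (rule quotientI) (simp add: g(1)[simplified])
  qed
  then have "s \<in> (lcosets\<^bsub>SL\<^esub> P) \<rightarrow>\<^sub>E line_bundle P \<nu>" using assms(1) by (simp add: PiE_iff)
  then show ?thesis
    unfolding global_sections_def mem_Collect_eq
    by (intro conjI exI[of _ f] ballI assms(2) eq fibre)
qed

text \<open>Both sides of the invariance equation are graphs over the same translated coset. Left
  multiplication by \<open>t\<close> is injective, so equality of the graphs is equality of the
  values.\<close>

lemma T_invariant_iff:
  assumes P: "subgroup P SL" and s: "\<And>x. x \<in> lcosets\<^bsub>SL\<^esub> P \<Longrightarrow> s x = graph_over f x"
  shows "T_invariant P \<mu> s \<longleftrightarrow>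
    (\<forall>t\<in>torus_T. \<forall>g\<in>carrier SL. f (t ** g) = torus_char \<mu> t * f g)"
proof -
  have coset: "g <#\<^bsub>SL\<^esub> P \<in> lcosets\<^bsub>SL\<^esub> P" if "g \<in> carrier SL" for g
    using that by (auto simp: LCOSETS_def)
  have sub: "P \<subseteq> carrier SL" using subgroup.subset[OF P] .
  have "s (t <#\<^bsub>SL\<^esub> (g <#\<^bsub>SL\<^esub> P)) = linearization \<mu> t (s (g <#\<^bsub>SL\<^esub> P)) \<longleftrightarrow>
      (\<forall>p\<in>P. f (t ** (g ** p)) = torus_char \<mu> t * f (g ** p))"
    if t: "t \<in> torus_T" and g: "g \<in> carrier SL" for t g
  proof -
    have det: "det t = 1" "det (t ** g) = 1" using t g by (auto simp: torus_T_def det_mul)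
    then have inj: "inj ((**) t)"
      by (metis injI invertible_det_nz invertible_left_inverse matrix_mul_assoc matrix_mul_lid zero_neq_one)
    have "s (t <#\<^bsub>SL\<^esub> (g <#\<^bsub>SL\<^esub> P)) = (\<lambda>p. (t ** (g ** p), f (t ** (g ** p)))) ` P"
      using det coset[of "t ** g"] unfolding l_coset_SL_assoc
      by (simp add: s) (simp add: l_coset_SL image_image matrix_mul_assoc)
    moreover have "linearization \<mu> t (s (g <#\<^bsub>SL\<^esub> P))
        = (\<lambda>p. (t ** (g ** p), torus_char \<mu> t * f (g ** p))) ` P"
      using coset[OF g] by (simp add: s linearization_def) (simp add: l_coset_SL image_image)
    moreover have "(\<lambda>p. (t ** (g ** p), f (t ** (g ** p)))) ` P
        = (\<lambda>p. (t ** (g ** p), torus_char \<mu> t * f (g ** p))) ` P \<longleftrightarrow>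
        (\<forall>p\<in>P. f (t ** (g ** p)) = torus_char \<mu> t * f (g ** p))" (is "?A = ?B \<longleftrightarrow> ?all")
    proof
      assume eq: "?A = ?B"
      show ?all
      proof
        fix p assume "p \<in> P"
        then have "(t ** (g ** p), f (t ** (g ** p))) \<in> ?B" unfolding eq[symmetric] by blast
        then obtain q where "t ** (g ** p) = t ** (g ** q)"
          "f (t ** (g ** p)) = torus_char \<mu> t * f (g ** q)" by blast
        then show "f (t ** (g ** p)) = torus_char \<mu> t * f (g ** p)"
          using injD[OF inj] by metis
      qed
    next
      assume ?all
      then show "?A = ?B" by (intro image_cong) auto
    qed
    ultimately show ?thesis by simp
  qed
  then have "T_invariant P \<mu> s \<longleftrightarrow> (\<forall>t\<in>torus_T. \<forall>g\<in>carrier SL. \<forall>p\<in>P.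
      f (t ** (g ** p)) = torus_char \<mu> t * f (g ** p))"
    unfolding T_invariant_def LCOSETS_def by auto
  also have "\<dots> \<longleftrightarrow> (\<forall>t\<in>torus_T. \<forall>g\<in>carrier SL. f (t ** g) = torus_char \<mu> t * f g)"
  proof
    assume *: "\<forall>t\<in>torus_T. \<forall>g\<in>carrier SL. \<forall>p\<in>P. f (t ** (g ** p)) = torus_char \<mu> t * f (g ** p)"
    have "mat 1 \<in> P" using subgroup.one_closed[OF P] by simp
    then show "\<forall>t\<in>torus_T. \<forall>g\<in>carrier SL. f (t ** g) = torus_char \<mu> t * f g"
      using * by (metis matrix_mul_rid)
  next
    assume *: "\<forall>t\<in>torus_T. \<forall>g\<in>carrier SL. f (t ** g) = torus_char \<mu> t * f g"
    have "g ** p \<in> carrier SL" if "g \<in> carrier SL" "p \<in> P" for g p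
      using that sub by (auto simp: det_mul)
    then show "\<forall>t\<in>torus_T. \<forall>g\<in>carrier SL. \<forall>p\<in>P. f (t ** (g ** p)) = torus_char \<mu> t * f (g ** p)"
      using * by blast
  qed
  finally show ?thesis .
qed

lemma graph_ne_zero_over: "graph_over f x \<noteq> zero_over x \<longleftrightarrow> (\<exists>h\<in>x. f h \<noteq> 0)"
  unfolding zero_over_def by (auto simp: set_eq_iff image_iff)

section \<open>Semi-invariants from semistability\<close>

text \<open>The coordinate sum of a weight is defined only modulo \<open>CARD('n)\<close>; a lift
  with sum zero allows \<open>lam\<close> and \<mu> to be lifted with equal sums.\<close>

lemma root_lattice_sum_zero:
  fixes w :: "'n::finite weight"
  assumes "w \<in> root_lattice"
  shows "\<exists>v. w = weight_of v \<and> (\<Sum>i\<in>UNIV. v$i) = 0"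
proof -
  let ?G = "\<lparr>carrier = UNIV, mult = (+), one = 0\<rparr> :: 'n weight monoid"
  have root: "\<exists>v. h = weight_of v \<and> (\<Sum>i\<in>UNIV. v$i) = 0" if "h \<in> root_set" for h :: "'n weight"
  proof -
    obtain i j where h: "h = weight_of (axis i 1 - axis j 1)"
      using \<open>h \<in> root_set\<close> by (auto simp: root_set_def)
    have "(\<Sum>k\<in>UNIV. (axis i 1 - axis j 1 :: int^'n)$k) = 0"
      by (simp add: sum_subtractf axis_def)
    then show ?thesis using h by blast
  qed
  have inv: "inv\<^bsub>?G\<^esub> h = - h" for h
    unfolding m_inv_def by (rule the_equality) (auto simp: eq_neg_iff_add_eq_0)
  from assms[unfolded root_lattice_def] show ?thesis
  proof induction
    case one
    have "(0 :: 'n weight) = weight_of 0" by (simp add: zero_weight_def)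
    then show ?case by (intro exI[of _ 0]) simp
  next
    case (incl h)
    then show ?case by (rule root)
  next
    case (inv h)
    then obtain v where "h = weight_of v" "(\<Sum>i\<in>UNIV. v$i) = 0" using root by blast
    then show ?case unfolding \<open>inv\<^bsub>?G\<^esub> h = - h\<close>
      by (intro exI[of _ "- v"]) (simp add: uminus_weight.abs_eq sum_negf)
  next
    case (eng h k)
    then obtain v u where "h = weight_of v" "(\<Sum>i\<in>UNIV. v$i) = 0"
      "k = weight_of u" "(\<Sum>i\<in>UNIV. u$i) = 0" by blast
    then show ?case
      by (intro exI[of _ "v + u"]) (simp add: plus_weight.abs_eq sum.distrib)
  qed
qed

text \<open>Subtracting the smallest entry keeps the class. Nonnegative entries can be counted by
  level sets.\<close>

lemma nonneg_weight_lift: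
  fixes \<nu> :: "'n::finite weight"
  shows "\<exists>a. \<nu> = weight_of a \<and> (\<forall>i. 0 \<le> a$i)"
proof (induction \<nu> rule: weight.abs_induct)
  case (1 b)
  define k where "k = Min (range (\<lambda>i. b$i))"
  have "b - (b - vec k) \<in> range vec" by simp
  then have "weight_of b = weight_of (b - vec k)" by (simp add: weight.abs_eq_iff)
  moreover have "0 \<le> (b - vec k)$i" for i by (simp add: k_def)
  ultimately show ?case by blast
qed

section \<open>Choice of the row sets and construction of the section\<close>

lemma sum_card_levels:
  fixes I :: "'c \<Rightarrow> 'n::finite set"
  assumes "finite C"
  shows "(\<Sum>j\<in>J. card {c \<in> C. j \<in> I c}) = (\<Sum>c\<in>C. card (J \<inter> I c))"
proof -
  have "(\<Sum>j\<in>J. \<Sum>c\<in>{c \<in> C. j \<in> I c}. 1) = (\<Sum>c\<in>C. \<Sum>j\<in>{j \<in> J. j \<in> I c}. 1::nat)"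
    by (rule sum.swap_restrict[OF _ assms]) simp
  then show ?thesis by (simp add: Int_def)
qed

text \<open>Rado's theorem assigns a level to each of \<open>m$i\<close> copies of every row
  \<open>i\<close>, the ground set being pairs of a row and a level. Equality of the total sums then
  leaves no slack in any rank or counting estimate.\<close>

lemma exists_row_sets:
  fixes g :: "complex^'n::{finite,linorder}^'n::{finite,linorder}" and a m :: "int^'n::{finite,linorder}"
  assumes "det g \<noteq> 0" and a: "\<And>j. 0 \<le> a$j"
    and sum: "(\<Sum>i\<in>UNIV. m$i) = (\<Sum>i\<in>UNIV. a$i)"
    and le: "\<And>S. (\<Sum>i\<in>S. m$i) \<le> (\<Sum>j\<in>pivots g S. a$j)"
  obtains I where "\<And>i. m$i = int (card {c \<in> {1..\<Sum>i\<in>UNIV. a$i}. i \<in> I c})"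
    "\<And>c. c \<in> {1..\<Sum>i\<in>UNIV. a$i} \<Longrightarrow> card (I c) = card (level_set a c)"
    "\<And>c. c \<in> {1..\<Sum>i\<in>UNIV. a$i} \<Longrightarrow> submatrix_rank g (level_set a c) (I c) = card (level_set a c)"
proof -
  let ?C = "{1..\<Sum>i\<in>UNIV. a$i}"
  \<comment> \<open>By \<open>le\<close> for the complement of \<open>i\<close>, the other entries
    of \<open>m\<close> sum to at most the total of \<open>a\<close>, which is the total of
    \<open>m\<close>.\<close>
  have m: "0 \<le> m$i" for i
  proof -
    have "(\<Sum>j\<in>pivots g (UNIV - {i}). a$j) \<le> (\<Sum>j\<in>UNIV. a$j)"
      using a by (intro sum_mono2) auto
    moreover have "(\<Sum>j\<in>UNIV. m$j) = m$i + (\<Sum>j\<in>UNIV - {i}. m$j)"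
      by (rule sum.remove) auto
    ultimately show ?thesis using le[of "UNIV - {i}"] sum by linarith
  qed
  have level_sum: "(\<Sum>j\<in>J. nat (a$j)) = (\<Sum>c\<in>?C. card (J \<inter> level_set a c))" for J
    using sum_card_levels[of ?C "level_set a" J] level_set_count[OF a] by simp
  \<comment> \<open>The rank function of a direct sum of row matroids, one for each level.\<close>
  define \<rho> where "\<rho> Z = (\<Sum>c\<in>?C. submatrix_rank g (level_set a c) {i. (i, c) \<in> Z})" for Z
  let ?N = "SIGMA i:UNIV. {..<nat (m$i)}" and ?A = "\<lambda>(i, l::nat). {i} \<times> ?C"
  have "\<exists>x. (\<forall>k\<in>?N. x k \<in> ?A k) \<and> card ?N \<le> \<rho> (x ` ?N)"
  proof (rule rado_submodular)
    show "finite ?N" by auto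
    show "finite (?A k)" for k by (cases k) auto
    show "\<rho> U \<le> \<rho> V" if "U \<subseteq> V" for U V
      unfolding \<rho>_def using that by (intro sum_mono submatrix_rank_mono) auto
    show "\<rho> (U \<union> V) + \<rho> (U \<inter> V) \<le> \<rho> U + \<rho> V" for U V
    proof -
      have "submatrix_rank g D {i. (i, c) \<in> U \<union> V} + submatrix_rank g D {i. (i, c) \<in> U \<inter> V}
          \<le> submatrix_rank g D {i. (i, c) \<in> U} + submatrix_rank g D {i. (i, c) \<in> V}" for D c
        using submatrix_rank_submodular[of g D "{i. (i, c) \<in> U}" "{i. (i, c) \<in> V}"]
        by (simp add: Collect_disj_eq Collect_conj_eq)
      then show ?thesis unfolding \<rho>_def sum.distrib[symmetric] by (intro sum_mono)
    qed
    show "\<rho> {} = 0"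
      using submatrix_rank_le_rows[OF assms(1), of _ "{}"] by (simp add: \<rho>_def)
    fix K assume K: "K \<subseteq> ?N"
    let ?S = "fst ` K"
    have "K \<subseteq> (SIGMA i:?S. {..<nat (m$i)})" using K by force
    then have "card K \<le> card (SIGMA i:?S. {..<nat (m$i)})" by (rule card_mono[rotated]) auto
    also have "\<dots> = (\<Sum>i\<in>?S. nat (m$i))" by simp
    also have "\<dots> \<le> (\<Sum>j\<in>pivots g ?S. nat (a$j))"
    proof -
      have "int (\<Sum>i\<in>?S. nat (m$i)) = (\<Sum>i\<in>?S. m$i)" using m by simp
      also have "\<dots> \<le> int (\<Sum>j\<in>pivots g ?S. nat (a$j))" using le[of ?S] a by simp
      finally show ?thesis by (simp only: of_nat_le_iff)
    qed
    \<comment> \<open>Summation by parts over the levels, followed by the rank bound for pivots in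
      each level set.\<close>
    also have "\<dots> \<le> (\<Sum>c\<in>?C. submatrix_rank g (level_set a c) ?S)"
      unfolding level_sum by (intro sum_mono pivots_Int_le_submatrix_rank)
    also have "\<dots> = \<rho> (\<Union>k\<in>K. ?A k)"
      unfolding \<rho>_def
    proof (rule sum.cong)
      fix c assume "c \<in> ?C"
      then have "{i. (i, c) \<in> (\<Union>k\<in>K. ?A k)} = ?S" by force
      then show "submatrix_rank g (level_set a c) ?S
          = submatrix_rank g (level_set a c) {i. (i, c) \<in> (\<Union>k\<in>K. ?A k)}" by simp
    qed simp
    finally show "card K \<le> \<rho> (\<Union>k\<in>K. ?A k)" .
  qed
  then obtain x where x: "\<And>k. k \<in> ?N \<Longrightarrow> x k \<in> ?A k" "card ?N \<le> \<rho> (x ` ?N)" by blast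
  define I where "I c = {i. (i, c) \<in> x ` ?N}" for c
  \<comment> \<open>Only an upper bound so far: several copies of \<open>i\<close> might receive the
    same level.\<close>
  have count: "card {c \<in> ?C. i \<in> I c} \<le> nat (m$i)" for i
  proof -
    have "{c \<in> ?C. i \<in> I c} \<subseteq> (\<lambda>l. snd (x (i, l))) ` {..<nat (m$i)}"
    proof
      fix c assume "c \<in> {c \<in> ?C. i \<in> I c}"
      then obtain k where k: "k \<in> ?N" "x k = (i, c)" by (auto simp: I_def)
      then have "fst k = i" using x(1)[OF k(1)] by (cases k) auto
      then have "k = (i, snd k)" "snd k < nat (m$i)" using k(1) by (cases k; auto)+
      then show "c \<in> (\<lambda>l. snd (x (i, l))) ` {..<nat (m$i)}"
        using k(2) by (intro image_eqI[of _ _ "snd k"]) auto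
    qed
    then have "card {c \<in> ?C. i \<in> I c} \<le> card {..<nat (m$i)}"
      by (rule surj_card_le[rotated]) simp
    then show ?thesis by simp
  qed
  have rank: "submatrix_rank g (level_set a c) (I c) \<le> card (I c)"
    "submatrix_rank g (level_set a c) (I c) \<le> card (level_set a c)" for c
    using submatrix_rank_le_rows[OF assms(1)] submatrix_rank_le_columns by blast+
  let ?r = "\<Sum>c\<in>?C. submatrix_rank g (level_set a c) (I c)"
  have N: "(\<Sum>i\<in>UNIV. nat (m$i)) \<le> ?r"
    using x(2) by (simp add: \<rho>_def I_def)
  have r1: "?r \<le> (\<Sum>c\<in>?C. card (I c))" "?r \<le> (\<Sum>c\<in>?C. card (level_set a c))"
    using rank by (auto intro: sum_mono)
  have r2: "(\<Sum>c\<in>?C. card (I c)) = (\<Sum>i\<in>UNIV. card {c \<in> ?C. i \<in> I c})"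
    using sum_card_levels[of ?C I UNIV] by simp
  have r3: "(\<Sum>i\<in>UNIV. card {c \<in> ?C. i \<in> I c}) \<le> (\<Sum>i\<in>UNIV. nat (m$i))"
    using count by (intro sum_mono)
  have "int (\<Sum>i\<in>UNIV. nat (m$i)) = int (\<Sum>i\<in>UNIV. nat (a$i))" using m a sum by simp
  then have "(\<Sum>i\<in>UNIV. nat (m$i)) = (\<Sum>i\<in>UNIV. nat (a$i))" by (simp only: of_nat_eq_iff)
  then have r4: "(\<Sum>i\<in>UNIV. nat (m$i)) = (\<Sum>c\<in>?C. card (level_set a c))"
    using level_sum[of UNIV] by simp
  \<comment> \<open>\<open>?r\<close> is squeezed between equal totals, so the termwise inequalities
    \<open>count\<close> and \<open>rank\<close> become equalities.\<close>
  have eq: "(\<Sum>i\<in>UNIV. card {c \<in> ?C. i \<in> I c}) = (\<Sum>i\<in>UNIV. nat (m$i))"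
    "?r = (\<Sum>c\<in>?C. card (I c))" "?r = (\<Sum>c\<in>?C. card (level_set a c))"
    using N r1 r2 r3 r4 by linarith+
  have eq1: "card {c \<in> ?C. i \<in> I c} = nat (m$i)" for i
    by (rule sum_mono_inv[OF eq(1)]) (use count in auto)
  have eq2: "submatrix_rank g (level_set a c) (I c) = card (I c)" if "c \<in> ?C" for c
    by (rule sum_mono_inv[OF eq(2) _ that]) (use rank in auto)
  have eq3: "submatrix_rank g (level_set a c) (I c) = card (level_set a c)" if "c \<in> ?C" for c
    by (rule sum_mono_inv[OF eq(3) _ that]) (use rank in auto)
  show thesis
    by (rule that[of I]) (use eq1 eq2 eq3 m in auto)
qed

text \<open>On the right, each minor acquires a principal minor of \<open>p\<close>, whatever its
  rows are; on the left, the torus sees only the rows, and row \<open>i\<close> occurs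
  \<open>m$i\<close> times.\<close>

lemma exists_semiinvariant:
  fixes g :: "complex^'n::{finite,linorder}^'n::{finite,linorder}" and a m :: "int^'n::{finite,linorder}"
  assumes "det g \<noteq> 0" and a: "\<And>j. 0 \<le> a$j"
    and "(\<Sum>i\<in>UNIV. m$i) = (\<Sum>i\<in>UNIV. a$i)"
    and "\<And>S. (\<Sum>i\<in>S. m$i) \<le> (\<Sum>j\<in>pivots g S. a$j)"
  obtains f where "holomorphic_on_submfd (carrier SL) f" "f g \<noteq> 0"
    "\<And>h p. p \<in> block_group a \<Longrightarrow> f (h ** p) = block_char a p * f h"
    "\<And>t h. t \<in> torus_T \<Longrightarrow> f (t ** h) = torus_char (weight_of m) t * f h"
proof -
  let ?C = "{1..\<Sum>i\<in>UNIV. a$i}"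
  obtain I where I: "\<And>i. m$i = int (card {c \<in> ?C. i \<in> I c})"
    "\<And>c. c \<in> ?C \<Longrightarrow> card (I c) = card (level_set a c)"
    "\<And>c. c \<in> ?C \<Longrightarrow> submatrix_rank g (level_set a c) (I c) = card (level_set a c)"
    using exists_row_sets[OF assms] by blast
  have "\<exists>\<tau>. c \<in> ?C \<longrightarrow> bij_betw \<tau> (- level_set a c) (- I c)" for c
    using finite_same_card_bij[of "- level_set a c" "- I c"] I(2)[of c]
    by (auto simp: card_complement)
  then obtain \<tau> where \<tau>: "\<And>c. c \<in> ?C \<Longrightarrow> bij_betw (\<tau> c) (- level_set a c) (- I c)"
    by metis
  define f where "f h = (\<Prod>c\<in>?C. flag_minor (level_set a c) (\<tau> c) h)" for h
  show thesis
  proof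
    show "holomorphic_on_submfd (carrier SL) f"
      unfolding f_def
      by (rule holomorphic_on_submfdI[OF _ refl])
        (intro holomorphic_at_matrix_prod holomorphic_flag_minor)
    have "flag_minor (level_set a c) (\<tau> c) g \<noteq> 0" if "c \<in> ?C" for c
      by (rule flag_minor_nonzero[OF I(3)[OF that] \<tau>[OF that]])
    then show "f g \<noteq> 0" unfolding f_def by (subst prod_zero_iff) blast+
    fix h
    show "f (h ** p) = block_char a p * f h" if "p \<in> block_group a" for p
      by (simp add: f_def block_char_def flag_minor_block_mult[OF that] prod.distrib)
    fix t :: "complex^'n::{finite,linorder}^'n::{finite,linorder}" assume t: "t \<in> torus_T"
    have "f (t ** h) = (\<Prod>c\<in>?C. (\<Prod>i\<in>I c. t$i$i) * flag_minor (level_set a c) (\<tau> c) h)"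
      unfolding f_def by (intro prod.cong refl flag_minor_torus[OF t] \<tau>)
    also have "\<dots> = (\<Prod>c\<in>?C. \<Prod>i\<in>I c. t$i$i) * f h" by (simp add: f_def prod.distrib)
    also have "(\<Prod>c\<in>?C. \<Prod>i\<in>I c. t$i$i) = torus_char (weight_of m) t"
      unfolding prod_over_levels[OF finite_atLeastAtMost_int] torus_char_weight_of[OF t] I(1)
      by simp
    finally show "f (t ** h) = torus_char (weight_of m) t * f h" .
  qed
qed

text \<open>The degeneration is applied on all of SL(n,C) with the weights multiplied by
  \<open>N\<close>; the positive factor \<open>N\<close> is cancelled at the end.\<close>

lemma semistable_imp_inequalities:
  fixes a m :: "int^'n::{finite,linorder}"
  assumes dom: "dominant (weight_of a)" and a: "\<And>j. 0 \<le> a$j"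
    and sum: "(\<Sum>i\<in>UNIV. m$i) = (\<Sum>i\<in>UNIV. a$i)" and "N > 0" and g: "g \<in> carrier SL"
    and f: "holomorphic_on_submfd (carrier SL) f" "f g \<noteq> 0"
    and right: "\<And>h p. h \<in> carrier SL \<Longrightarrow> p \<in> block_group a \<Longrightarrow>
      f (h ** p) = ext_char (block_group a) (nmult N (weight_of a)) p * f h"
    and left: "\<And>t h. t \<in> torus_T \<Longrightarrow> h \<in> carrier SL \<Longrightarrow>
      f (t ** h) = torus_char (nmult N (weight_of m)) t * f h"
  shows "(\<Sum>i\<in>S. m$i) \<le> (\<Sum>j\<in>pivots g S. a$j)"
proof -
  note ext = extends_to_block_char_power[OF a, where N = N]
  have ec: "ext_char (block_group a) (nmult N (weight_of a)) p = block_char a p ^ N"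
    if "p \<in> block_group a" for p by (rule ext_char_eq[OF ext that])
  have et: "ext_char (block_group a) (nmult N (weight_of a)) t = torus_char (weight_of (\<chi> i. int N * a$i)) t"
    if "t \<in> torus_T" for t
    using ec[of t] ext that torus_in_block_group[of a]
    by (auto simp: extends_to_def nmult.abs_eq)
  have "(\<Sum>i\<in>S. (\<chi> i. int N * m$i)$i) \<le> (\<Sum>j\<in>pivots g S. (\<chi> i. int N * a$i)$j)"
  proof (rule equivariant_exponent(1)[OF _ closed_SL subset_refl g])
    show "continuous_on (carrier SL) f" by (rule holomorphic_on_submfd_continuous_on[OF f(1)])
    fix t A :: "complex^'n::{finite,linorder}^'n::{finite,linorder}"
    assume t: "t \<in> torus_T" and A: "A \<in> carrier SL"
    then show "t ** A \<in> carrier SL \<and> f (t ** A) = torus_char (weight_of (\<chi> i. int N * m$i)) t * f A"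
      using left by (simp add: nmult.abs_eq det_mul torus_T_def)
    show "A ** t \<in> carrier SL \<and> f (A ** t) = torus_char (weight_of (\<chi> i. int N * a$i)) t * f A"
      using t A torus_in_block_group[of a] right[OF A, of t] et[OF t]
      by (auto simp: det_mul torus_T_def)
  next
    fix b :: "complex^'n::{finite,linorder}^'n::{finite,linorder}" assume "b \<in> borel_B"
    then have b: "b \<in> block_group a" using borel_in_block_group[OF dom] by blast
    then show "g ** b \<in> carrier SL \<and> f (g ** b) \<noteq> 0"
      using right[OF g b] ec[OF b] block_char_nonzero[OF b] f(2) g
      by (simp add: det_mul block_group_def)
  qed (use sum in \<open>simp flip: sum_distrib_left\<close>)
  then show ?thesis using \<open>N > 0\<close> by (simp flip: sum_distrib_left)
qed

theorem theorem2p2: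
  fixes lam \<mu> :: "'n::{finite,linorder} weight" and x :: "(complex^'n::{finite,linorder}^'n::{finite,linorder}) set"
  assumes "CARD('n) \<ge> 2"
    and "dominant lam"
    and "lam - \<mu> \<in> root_lattice"
    and "x \<in> lcosets\<^bsub>SL\<^esub> (P_of lam)"
    and "semistable lam \<mu> x"
  shows "\<exists>s\<in>global_sections (P_of lam) lam. T_invariant (P_of lam) \<mu> s \<and> s x \<noteq> zero_over x"
proof -
  obtain a where lam: "lam = weight_of a" and a: "\<And>i. 0 \<le> a$i"
    using nonneg_weight_lift[of lam] by blast
  obtain v where v: "lam - \<mu> = weight_of v" "(\<Sum>i\<in>UNIV. v$i) = 0"
    using root_lattice_sum_zero[OF assms(3)] by blast
  \<comment> \<open>\<open>m\<close> lifts \<open>lam - (lam - \<mu>)\<close> and has the coordinate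
    sum of \<open>a\<close>, because \<open>v\<close> sums to zero.\<close>
  define m where "m = a + - v"
  have "\<mu> = lam + - (lam - \<mu>)" by simp
  then have \<mu>: "\<mu> = weight_of m"
    unfolding v(1) unfolding lam m_def by (simp add: plus_weight.abs_eq uminus_weight.abs_eq)
  have sum: "(\<Sum>i\<in>UNIV. m$i) = (\<Sum>i\<in>UNIV. a$i)"
    using v(2) by (simp add: m_def sum_subtractf)
  have dom: "dominant (weight_of a)" using assms(2) lam by simp
  let ?P = "block_group a"
  have P: "P_of lam = ?P" unfolding lam by (rule P_of_eq_block_group[OF dom a])
  have sub: "subgroup ?P SL" by (rule subgroup_block_group)
  from assms(5) obtain N s where N: "N > 0" and s: "s \<in> global_sections ?P (nmult N lam)"
    "T_invariant ?P (nmult N \<mu>) s" "s x \<noteq> zero_over x"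
    unfolding semistable_def P by blast
  from s(1) obtain f where f: "holomorphic_on_submfd (carrier SL) f"
    "\<And>g p. g \<in> carrier SL \<Longrightarrow> p \<in> ?P \<Longrightarrow> f (g ** p) = ext_char ?P (nmult N lam) p * f g"
    "\<And>y. y \<in> lcosets\<^bsub>SL\<^esub> ?P \<Longrightarrow> s y = graph_over f y"
    by (rule global_sectionsE) blast
  have x: "x \<in> lcosets\<^bsub>SL\<^esub> ?P" using assms(4) P by simp
  obtain g where g: "g \<in> x" "f g \<noteq> 0"
    using s(3) f(3)[OF x] graph_ne_zero_over[of f x] by auto
  have gSL: "g \<in> carrier SL"
    using group.lcosets_part_G[OF group_SL sub] x g(1) by blast
  have le: "(\<Sum>i\<in>S. m$i) \<le> (\<Sum>j\<in>pivots g S. a$j)" for S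
  proof (rule semistable_imp_inequalities[OF dom a sum N gSL f(1) g(2)])
    have "T_invariant ?P (nmult N \<mu>) s \<longleftrightarrow>
        (\<forall>t\<in>torus_T. \<forall>h\<in>carrier SL. f (t ** h) = torus_char (nmult N \<mu>) t * f h)"
      by (rule T_invariant_iff[OF sub f(3)])
    then show "f (t ** h) = torus_char (nmult N (weight_of m)) t * f h"
      if "t \<in> torus_T" "h \<in> carrier SL" for t h
      using s(2) that \<mu> by simp
  qed (use f(2) lam in auto)
  have "det g \<noteq> 0" using gSL by simp
  then obtain F where F: "holomorphic_on_submfd (carrier SL) F" "F g \<noteq> 0"
    "\<And>h p. p \<in> ?P \<Longrightarrow> F (h ** p) = block_char a p * F h"
    "\<And>t h. t \<in> torus_T \<Longrightarrow> F (t ** h) = torus_char (weight_of m) t * F h"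
    using exists_semiinvariant[OF _ a sum le] by blast
  have "nmult 1 (weight_of a) = weight_of a" by (simp add: nmult.abs_eq)
  then have "extends_to lam ?P (\<lambda>p. block_char a p ^ 1)"
    using extends_to_block_char_power[OF a, where N = 1] lam by metis
  then have ext: "ext_char ?P lam p = block_char a p" if "p \<in> ?P" for p
    using ext_char_eq[OF _ that] by fastforce
  \<comment> \<open>Global sections are extensional on the cosets, hence the restriction.\<close>
  define \<sigma> where "\<sigma> = restrict (graph_over F) (lcosets\<^bsub>SL\<^esub> ?P)"
  have \<sigma>: "\<sigma> y = graph_over F y" if "y \<in> lcosets\<^bsub>SL\<^esub> ?P" for y
    using that by (simp add: \<sigma>_def)
  have "\<sigma> \<in> global_sections ?P lam"
  proof (rule global_sectionsI[OF _ F(1)])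
    show "\<sigma> \<in> extensional (lcosets\<^bsub>SL\<^esub> ?P)" by (simp add: \<sigma>_def)
  qed (auto simp: F ext \<sigma>)
  moreover have "T_invariant ?P \<mu> \<sigma>"
    by (subst T_invariant_iff[OF sub \<sigma>]) (simp_all add: F(4) \<mu>)
  moreover have "\<sigma> x \<noteq> zero_over x"
    unfolding \<sigma>[OF x] graph_ne_zero_over using F(2) g(1) by blast
  ultimately show ?thesis unfolding P by blast
qed

end
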